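(* Let $\mathbf{k}$ be an algebraically closed field and $R=\mathbf{k}[s,u,t,v]$ the bigraded coordinate ring of $\mathbf{P}^1\times\mathbf{P}^1$. Let $a,b,c\in R$ be bihomogeneous polynomials of bidegree $(m,n)$, let $I=\langle a,b,c\rangle$, and suppose that $Z=\mathbb{V}(a,b,c)\subset \mathbf{P}^1\times\mathbf{P}^1$ is finite. Suppose that all the base points of $a,b,c$ (that is, all points of $Z$) are curvilinear. Let $(k,l)$ satisfy $(k-2m+1)(l-2n+1)\ge 0$. Then every syzygy $Aa+Bb+Cc=0$ of pure bidegree $(k,l)$ (that is, $A,B,C\in R$ are all bihomogeneous of bidegree $(k,l)$) which vanishes at the base points of $I$ is a Koszul syzygy; that is, there exist $h_1,h_2,h_3\in R$ bihomogeneous of bidegree $(k-m,l-n)$ such that $$A=h_1c+h_2b,\qquad B=-h_2a+h_3c,\qquad C=-h_1a-h_3b.$$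
   Context: The ring $R=\mathbf{k}[s,u,t,v]$ is bigraded with $s,u$ of bidegree $(1,0)$ and $t,v$ of bidegree $(0,1)$; the irrelevant ideal is $\mathbf{m}=\langle st,sv,ut,uv\rangle$. A bihomogeneous ideal $I\subset R$ defines a coherent ideal sheaf $\mathcal{I}$ on $\mathbf{P}^1\times\mathbf{P}^1$, with zero set $\mathbb{V}(I)$. Curvilinear: $I$ (or the base point $p\in Z$) is curvilinear at $p$ if in the completed local ring $\widehat{\mathcal{O}}_{p}$ of $\mathbf{P}^1\times\mathbf{P}^1$ at $p$ there are analytic coordinates $x,y$, so that $\widehat{\mathcal{O}}_{p}=\mathbf{k}[[x,y]]$, such that $\widehat{\mathcal{I}}_p=\langle x,y^r\rangle$ for some integer $r\ge 1$. Vanishing at base points: a syzygy $(A,B,C)$ vanishes at the base points of $I$ if $A,B,C\in I^{\mathrm{sat}}$, where $I^{\mathrm{sat}}=\{r\in R:\mathbf{m}^j r\subset I\text{ for some } j\}$. Equivalently, for $A,B,C$ of bidegree $(k,l)$, each of them is a global section of $\mathcal{I}(k,l)=\mathcal{I}\otimes\mathcal{O}_{\mathbf{P}^1\times\mathbf{P}^1}(k,l)$. A nonzero bihomogeneous polynomial has bidegree with nonnegative entries; the only element of $R$ of a bidegree with a negative entry is $0$. *)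

theory Defs
  imports
    "HOL-Library.Poly_Mapping"
    "HOL-Computational_Algebra.Computational_Algebra"
begin

section \<open>The bigraded ring \<open>R = k[s,u,t,v]\<close>\<close>

datatype var = VS | VU | VT | VV

type_synonym 'k bipoly = "(var \<Rightarrow>\<^sub>0 nat) \<Rightarrow>\<^sub>0 'k"

definition X_of :: "var \<Rightarrow> 'k::comm_ring_1 bipoly" where
  "X_of x = Poly_Mapping.single (Poly_Mapping.single x 1) 1"

text \<open>Bidegrees are integers: \<open>0\<close> is bihomogeneous of every bidegree and is the only
  element of a bidegree with a negative entry.\<close>

definition bihomogeneous :: "int \<Rightarrow> int \<Rightarrow> 'k::comm_ring_1 bipoly \<Rightarrow> bool" where
  "bihomogeneous i j f \<longleftrightarrow>
     (\<forall>e \<in> Poly_Mapping.keys f.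
        int (Poly_Mapping.lookup e VS + Poly_Mapping.lookup e VU) = i \<and>
        int (Poly_Mapping.lookup e VT + Poly_Mapping.lookup e VV) = j)"

text \<open>Substitution \<open>x \<mapsto> \<phi> x\<close> for the variables, with the coefficients transported along \<open>\<iota>\<close>.\<close>

definition poly_subst ::
    "('k::comm_ring_1 \<Rightarrow> 'r::comm_ring_1) \<Rightarrow> (var \<Rightarrow> 'r) \<Rightarrow> 'k bipoly \<Rightarrow> 'r" where
  "poly_subst \<iota> \<phi> f =
     (\<Sum>e \<in> Poly_Mapping.keys f. \<iota> (Poly_Mapping.lookup f e) *
        (\<Prod>x \<in> {VS, VU, VT, VV}. \<phi> x ^ Poly_Mapping.lookup e x))"


section \<open>Ideals and saturation\<close>

text \<open>Ideals of a commutative ring are the submodules of the ring over itself.\<close>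

definition ideal_gen :: "'a::comm_ring_1 set \<Rightarrow> 'a set" where
  "ideal_gen S = module.span (*) S"

lemma module_times: "module ((*) :: 'a::comm_ring_1 \<Rightarrow> 'a \<Rightarrow> 'a)"
  by unfold_locales (simp_all add: algebra_simps)

primrec ideal_power :: "'a::comm_ring_1 set \<Rightarrow> nat \<Rightarrow> 'a set" where
  "ideal_power I 0 = UNIV"
| "ideal_power I (Suc j) = ideal_gen {x * y | x y. x \<in> I \<and> y \<in> ideal_power I j}"

definition irrelevant_ideal :: "'k::comm_ring_1 bipoly set" where
  "irrelevant_ideal =
     ideal_gen {X_of VS * X_of VT, X_of VS * X_of VV, X_of VU * X_of VT, X_of VU * X_of VV}"

definition saturation :: "'k::comm_ring_1 bipoly set \<Rightarrow> 'k bipoly set" where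
  "saturation I = {r. \<exists>j. \<forall>x \<in> ideal_power irrelevant_ideal j. x * r \<in> I}"


section \<open>Points of \<open>P\<^sup>1 \<times> P\<^sup>1\<close> and zero sets\<close>

text \<open>A point of \<open>P\<^sup>1\<close> is the set of all its homogeneous coordinate vectors.\<close>

definition proj_rel :: "(('k::field \<times> 'k) \<times> ('k \<times> 'k)) set" where
  "proj_rel = {((x0, x1), (y0, y1)). (x0, x1) \<noteq> (0, 0) \<and>
                 (\<exists>c. c \<noteq> 0 \<and> y0 = c * x0 \<and> y1 = c * x1)}"

definition proj_line :: "('k::field \<times> 'k) set set" where
  "proj_line = (UNIV - {(0, 0)}) // proj_rel"

fun coords :: "'r \<times> 'r \<Rightarrow> 'r \<times> 'r \<Rightarrow> var \<Rightarrow> 'r" where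
  "coords (x, y) (z, w) VS = x"
| "coords (x, y) (z, w) VU = y"
| "coords (x, y) (z, w) VT = z"
| "coords (x, y) (z, w) VV = w"

definition zero_set ::
    "'k::field bipoly set \<Rightarrow> (('k \<times> 'k) set \<times> ('k \<times> 'k) set) set" where
  "zero_set F = {(P, Q). P \<in> proj_line \<and> Q \<in> proj_line \<and>
     (\<forall>f \<in> F. \<forall>p \<in> P. \<forall>q \<in> Q. poly_subst id (coords p q) f = 0)}"


section \<open>Completed local rings and curvilinear points\<close>

text \<open>
  The completed local ring at a point is the power series ring \<open>k[[X, Y]]\<close>, rendered as the type
  \<open>'k fps fps\<close>, where \<open>X\<close> and \<open>Y\<close> are the Taylor variables of the two factors at the point.
  At \<open>[s0 : u0]\<close> the affine coordinate used is \<open>u/s = u0/s0 + X\<close> if \<open>s0 \<noteq> 0\<close>, and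
  \<open>s/u = X\<close> otherwise; similarly for \<open>[t0 : v0]\<close> and \<open>Y\<close>.
\<close>

definition ser_const :: "'k::field \<Rightarrow> 'k fps fps" where
  "ser_const c = fps_const (fps_const c)"

definition ser_X :: "'k::field fps fps" where
  "ser_X = fps_const fps_X"

definition ser_Y :: "'k::field fps fps" where
  "ser_Y = fps_X"

definition taylor_coords :: "'k::field \<times> 'k \<Rightarrow> 'k fps fps \<Rightarrow> 'k fps fps \<times> 'k fps fps" where
  "taylor_coords p z =
     (if fst p \<noteq> 0 then (1, ser_const (snd p / fst p) + z) else (z, 1))"

definition germ :: "'k::field \<times> 'k \<Rightarrow> 'k \<times> 'k \<Rightarrow> 'k bipoly \<Rightarrow> 'k fps fps" where
  "germ p q = poly_subst ser_const (coords (taylor_coords p ser_X) (taylor_coords q ser_Y))"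

lemma germ_scale:
  assumes "c \<noteq> 0" "d \<noteq> 0"
  shows "germ (c * s0, c * u0) (d * t0, d * v0) = germ (s0, u0) (t0, v0)"
  using assms by (simp add: germ_def taylor_coords_def)

text \<open>The completed stalk of the ideal sheaf of a bihomogeneous ideal \<open>I\<close>.\<close>

definition local_ideal :: "'k::field bipoly set \<Rightarrow> 'k \<times> 'k \<Rightarrow> 'k \<times> 'k \<Rightarrow> 'k fps fps set" where
  "local_ideal I p q = ideal_gen (germ p q ` I)"

text \<open>\<open>x, y\<close> are analytic coordinates if the completed local ring is \<open>k[[x,y]]\<close>, i.e. if \<open>x, y\<close> are
  the images of the variables under some isomorphism of \<open>k\<close>-algebras from the power series ring in
  two variables. Such an isomorphism is local, hence automatically continuous.\<close>

definition analytic_coordinates :: "'k::field fps fps \<Rightarrow> 'k fps fps \<Rightarrow> bool" where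
  "analytic_coordinates x y \<longleftrightarrow>
     (\<exists>\<phi> :: 'k fps fps \<Rightarrow> 'k fps fps. bij \<phi> \<and>
        (\<forall>f g. \<phi> (f + g) = \<phi> f + \<phi> g) \<and> (\<forall>f g. \<phi> (f * g) = \<phi> f * \<phi> g) \<and>
        (\<forall>c. \<phi> (ser_const c) = ser_const c) \<and> \<phi> ser_X = x \<and> \<phi> ser_Y = y)"

text \<open>By \<open>germ_scale\<close> the choice of the homogeneous coordinates \<open>p\<close>, \<open>q\<close> is immaterial.\<close>

definition curvilinear_at ::
    "'k::field bipoly set \<Rightarrow> ('k \<times> 'k) set \<times> ('k \<times> 'k) set \<Rightarrow> bool" where
  "curvilinear_at I z \<longleftrightarrow> (\<forall>p \<in> fst z. \<forall>q \<in> snd z.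
     \<exists>x y. \<exists>r::nat. analytic_coordinates x y \<and> r \<ge> 1 \<and> local_ideal I p q = ideal_gen {x, y ^ r})"

end

theory Submission
  imports Defs
begin

text \<open>
  On the product of two projective lines, consider the sheaf complex
  \<open>O(k - 2m, l - 2n) \<rightarrow> O(k - m, l - n)^3 \<rightarrow> O(k, l)^3 \<rightarrow> O(k + m, l + n)\<close> obtained by twisting the Koszul
  complex of \<open>a, b, c\<close>. A syzygy \<open>w = (A, B, C)\<close> that vanishes at the base points is locally a Koszul
  syzygy. The first map, multiplication by \<open>(b, -c, -a)\<close>, is onto the kernel of the second one, so the
  obstruction to lifting \<open>w\<close> globally lies in the cohomology group \<open>H^1(O(k - 2m, l - 2n))\<close>. This group
  vanishes exactly if \<open>(k - 2m + 1) (l - 2n + 1) \<ge> 0\<close>.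

  Finiteness of the base locus is used through elimination (\<open>elimination_x\<close>, \<open>elimination_y\<close>): on an
  affine chart with coordinates \<open>x, y\<close> the ideal of \<open>a, b, c\<close> contains nonzero polynomials \<open>P(x)\<close> and
  \<open>Q(y)\<close>. These are coprime, which yields the exactness statements about the Koszul complex
  (\<open>proportional_up_to_factor\<close>, \<open>proportional_bihomogeneous\<close>).

  Local part. Away from the base points one of \<open>a, b, c\<close> is invertible and all syzygies are Koszul. At a
  curvilinear base point the completed ideal has two generators, so some combination of \<open>a, b, c\<close> with
  constant coefficients, not all zero, lies in the product of the ideal with the maximal ideal. Since the
  ideal contains powers of \<open>x\<close> and \<open>y\<close> up to units, this relation can be truncated to one between
  polynomials (\<open>syzygy_of_relation\<close>). So near the point one of the three, say \<open>c\<close>, is a combination of the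
  two others. As \<open>C\<close> lies in the ideal, Koszul syzygies can be used to reduce to \<open>C = 0\<close>, and the syzygies
  of the regular sequence \<open>a, b\<close> are Koszul (\<open>koszul_of_syzygy\<close>). The polynomials \<open>f\<close> for which \<open>f w\<close> is
  Koszul therefore form an ideal without zeros, and \<open>w\<close> is Koszul on each affine chart
  (\<open>koszul_on_chart\<close>).

  Global part. In homogeneous terms, \<open>(st)^N w\<close>, \<open>(sv)^N w\<close>, \<open>(ut)^N w\<close> and \<open>(uv)^N w\<close> are Koszul for some
  \<open>N\<close>. The vanishing of \<open>H^1\<close> becomes an argument about exponents of monomials: the lifts are first glued
  along \<open>s, u\<close> and then along \<open>t, v\<close>, and in each step the cocycle has to lie in the ideal of the \<open>N\<close>-th
  powers of these two variables (\<open>koszul_via_descent\<close>). If the relevant entry of \<open>(k - 2m, l - 2n)\<close> is at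
  least \<open>-1\<close>, every monomial of the cocycle has an exponent of at least \<open>N\<close>. If both entries are at most \<open>-1\<close>,
  the first step uses the compatibility of the four cocycles (\<open>in_powers_cocycle\<close>), and the cocycle of the
  second step has negative degree.
\<close>

section \<open>Elimination in the polynomial ring in two variables\<close>

lemma infinite_UNIV_alg_closed: "infinite (UNIV :: 'k::alg_closed_field set)"
proof
  assume fin: "finite (UNIV :: 'k set)"
  define p where "p = (\<Prod>a\<in>(UNIV :: 'k set). [:-a, 1:])"
  have deg: "degree p = card (UNIV :: 'k set)"
    unfolding p_def by (subst degree_prod_eq_sum_degree) auto
  have "card (UNIV :: 'k set) > 0"
    using fin by (simp add: card_gt_0_iff)
  then have "degree (p + 1) > 0"
    using deg by (simp add: degree_add_eq_left)
  then obtain x where "poly (p + 1) x = 0"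
    using alg_closed_imp_poly_has_root by blast
  moreover have "poly p x = 0"
    unfolding p_def poly_prod using fin by (auto simp: prod_zero_iff)
  ultimately show False by simp
qed

lemma ideal_gen_three_iff:
  "x \<in> ideal_gen {a, b, c} \<longleftrightarrow> (\<exists>f g h. x = f * a + g * b + h * c)"
  for x :: "'a::comm_ring_1"
  unfolding ideal_gen_def module.span_insert[OF module_times] module.span_empty[OF module_times]
  by (auto simp: algebra_simps)

lemma ideal_gen_two_iff:
  "x \<in> ideal_gen {a, b} \<longleftrightarrow> (\<exists>f g. x = f * a + g * b)"
  for x :: "'a::comm_ring_1"
  unfolding ideal_gen_def module.span_insert[OF module_times] module.span_empty[OF module_times]
  by (auto simp: algebra_simps)

lemma ideal_gen_base: "x \<in> S \<Longrightarrow> x \<in> ideal_gen S"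
  unfolding ideal_gen_def by (rule module.span_base[OF module_times])

lemma ideal_gen_diff: "x \<in> ideal_gen S \<Longrightarrow> y \<in> ideal_gen S \<Longrightarrow> x - y \<in> ideal_gen S"
  unfolding ideal_gen_def by (rule module.span_diff[OF module_times])

lemma ideal_gen_mult: "x \<in> ideal_gen S \<Longrightarrow> r * x \<in> ideal_gen S"
  unfolding ideal_gen_def by (rule module.span_scale[OF module_times])

definition eval2 :: "'k::comm_ring_1 \<Rightarrow> 'k \<Rightarrow> 'k poly poly \<Rightarrow> 'k" where
  "eval2 x y g = poly (poly g [:y:]) x"

lemma eval2_simps [simp]:
  "eval2 x y (f + g) = eval2 x y f + eval2 x y g"
  "eval2 x y (f - g) = eval2 x y f - eval2 x y g"
  "eval2 x y (- f) = - eval2 x y f"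
  "eval2 x y (f * g) = eval2 x y f * eval2 x y g"
  "eval2 x y (f ^ n) = eval2 x y f ^ n"
  "eval2 x y 0 = 0" "eval2 x y 1 = 1"
  "eval2 x y [:p:] = poly p x"
  "eval2 x y (smult p f) = poly p x * eval2 x y f"
  by (simp_all add: eval2_def poly_power)

lemma eval2_conv_map_poly: "eval2 x y g = poly (map_poly (\<lambda>p. poly p x) g) y"
  by (induction g) (simp_all add: eval2_def map_poly_pCons)

text \<open>
  The finite set \<open>S\<close> of exceptional coordinates allows the test points to be taken off the coordinate
  lines, where all affine charts overlap.
\<close>

lemma bivariate_eq_0I:
  fixes g :: "'k::alg_closed_field poly poly"
  assumes "finite S" and "\<And>x y. x \<notin> S \<Longrightarrow> y \<notin> S \<Longrightarrow> eval2 x y g = 0"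
  shows "g = 0"
proof (rule ccontr)
  assume "g \<noteq> 0"
  then obtain d where d: "coeff g d \<noteq> 0" by (meson leading_coeff_0_iff)
  have inf: "infinite (- S)"
    using assms(1) infinite_UNIV_alg_closed by (metis finite_compl)
  have "infinite (- S - {x. poly (coeff g d) x = 0})"
    using inf poly_roots_finite[OF d] by (simp add: Diff_infinite_finite)
  then obtain x where x: "x \<notin> S" "poly (coeff g d) x \<noteq> 0"
    by (metis (mono_tags, lifting) ComplD DiffE infinite_imp_nonempty all_not_in_conv mem_Collect_eq)
  define h where "h = map_poly (\<lambda>p. poly p x) g"
  have "coeff h d \<noteq> 0" using x by (simp add: h_def coeff_map_poly)
  then have h: "h \<noteq> 0" by auto
  have "- S \<subseteq> {y. poly h y = 0}"
    using assms(2) x by (auto simp: h_def eval2_conv_map_poly)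
  then show False using poly_roots_finite[OF h] inf finite_subset by blast
qed

text \<open>
  Let \<open>g\<close> be a nonzero element of the ideal of least degree in \<open>y\<close>. Pseudo-division by \<open>g\<close> leaves no
  remainder on elements of the ideal, so \<open>a\<close>, \<open>b\<close>, \<open>c\<close> vanish at all zeros of \<open>g\<close> except over finitely
  many \<open>x\<close>. If the degree of \<open>g\<close> in \<open>y\<close> were positive, \<open>g\<close> would have a zero over almost every \<open>x\<close>.
\<close>

lemma elimination_x:
  fixes a b c :: "'k::alg_closed_field poly poly"
  assumes fin: "finite {(x, y). eval2 x y a = 0 \<and> eval2 x y b = 0 \<and> eval2 x y c = 0}"
  shows "\<exists>P. P \<noteq> 0 \<and> [:P:] \<in> ideal_gen {a, b, c}"
proof -
  define I where "I = ideal_gen {a, b, c}"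
  have gens: "a \<in> I" "b \<in> I" "c \<in> I" by (auto simp: I_def intro: ideal_gen_base)
  have "\<exists>g \<in> I. g \<noteq> 0"
  proof (rule ccontr)
    assume "\<not> ?thesis"
    then have "a = 0" "b = 0" "c = 0" using gens by auto
    then have "finite (UNIV :: ('k \<times> 'k) set)" using fin by simp
    then show False
      using infinite_UNIV_alg_closed[where 'k='k] by (simp add: finite_prod)
  qed
  then obtain g where g: "g \<in> I" "g \<noteq> 0"
    and min: "\<And>f. f \<in> I \<Longrightarrow> f \<noteq> 0 \<Longrightarrow> degree g \<le> degree f"
    using ex_has_least_nat[of "\<lambda>g. g \<in> I \<and> g \<noteq> 0" _ degree] by blast
  have div: "\<exists>q r. q \<noteq> 0 \<and> smult q f = g * r" if f: "f \<in> I" for f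
  proof -
    obtain q r where qr: "q \<noteq> 0" "smult q f = g * r + pseudo_mod f g"
      using pseudo_mod(1)[OF g(2)] by blast
    have "pseudo_mod f g = [:q:] * f - r * g"
      using qr(2) by (simp add: algebra_simps)
    then have "pseudo_mod f g \<in> I"
      unfolding I_def using f g(1) by (metis I_def ideal_gen_diff ideal_gen_mult)
    then have "pseudo_mod f g = 0"
      using pseudo_mod(2)[OF g(2), of f] min by fastforce
    then show ?thesis using qr by auto
  qed
  show ?thesis
  proof (cases "degree g = 0")
    case True
    then obtain P where "g = [:P:]" by (elim degree_eq_zeroE)
    then show ?thesis using g by (auto simp: I_def)
  next
    case False
    obtain qa ra where a: "qa \<noteq> 0" "smult qa a = g * ra" using div gens by blast
    obtain qb rb where b: "qb \<noteq> 0" "smult qb b = g * rb" using div gens by blast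
    obtain qc rc where c: "qc \<noteq> 0" "smult qc c = g * rc" using div gens by blast
    define q where "q = lead_coeff g * qa * qb * qc"
    have q: "q \<noteq> 0" using a b c g(2) by (simp add: q_def)
    have "\<exists>y. eval2 x y a = 0 \<and> eval2 x y b = 0 \<and> eval2 x y c = 0" if x: "poly q x \<noteq> 0" for x
    proof -
      have "coeff (map_poly (\<lambda>p. poly p x) g) (degree g) \<noteq> 0"
        using x by (auto simp: q_def coeff_map_poly)
      then have "degree (map_poly (\<lambda>p. poly p x) g) > 0"
        using False le_degree by (metis gr0I le_zero_eq)
      then obtain y where y: "eval2 x y g = 0"
        using alg_closed_imp_poly_has_root by (metis eval2_conv_map_poly)
      have "poly qa x * eval2 x y a = 0" "poly qb x * eval2 x y b = 0" "poly qc x * eval2 x y c = 0"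
        using y by (simp_all flip: eval2_simps(9) add: a b c)
      then show ?thesis using x by (auto simp: q_def)
    qed
    then have "- {x. poly q x = 0} \<subseteq>
        fst ` {(x, y). eval2 x y a = 0 \<and> eval2 x y b = 0 \<and> eval2 x y c = 0}"
      by (force simp: image_iff)
    then have "finite (- {x. poly q x = 0})" using fin finite_surj by blast
    then have "finite (UNIV :: 'k set)"
      using poly_roots_finite[OF q] by (metis finite_Un Compl_partition)
    then show ?thesis using infinite_UNIV_alg_closed by blast
  qed
qed

section \<open>Syzygies of three polynomials in two variables\<close>

text \<open>
  A homomorphism is a predicate on functions here, because it is needed for substitutions and
  evaluations that depend on points and on other polynomials.
\<close>

definition ring_map :: "('a::comm_ring_1 \<Rightarrow> 'b::comm_ring_1) \<Rightarrow> bool" where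
  "ring_map h \<longleftrightarrow> h 1 = 1 \<and> (\<forall>x y. h (x + y) = h x + h y) \<and> (\<forall>x y. h (x * y) = h x * h y)"

lemma ring_map_one: "ring_map h \<Longrightarrow> h 1 = 1"
  and ring_map_add: "ring_map h \<Longrightarrow> h (x + y) = h x + h y"
  and ring_map_mult: "ring_map h \<Longrightarrow> h (x * y) = h x * h y"
  by (simp_all add: ring_map_def)

lemma ring_map_zero: "ring_map h \<Longrightarrow> h 0 = 0"
  using ring_map_add[of h 0 0] by simp

lemma ring_map_minus: "ring_map h \<Longrightarrow> h (- x) = - h x"
  using ring_map_add[of h x "- x"] ring_map_zero[of h] by (simp add: eq_neg_iff_add_eq_0 add.commute)

lemma ring_map_diff: "ring_map h \<Longrightarrow> h (x - y) = h x - h y"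
  using ring_map_add[of h x "- y"] ring_map_minus[of h y] by simp

lemma ring_map_sum: "ring_map h \<Longrightarrow> h (sum f A) = (\<Sum>i\<in>A. h (f i))"
  by (induction A rule: infinite_finite_induct) (simp_all add: ring_map_zero ring_map_add)

lemma ring_map_prod: "ring_map h \<Longrightarrow> h (prod f A) = (\<Prod>i\<in>A. h (f i))"
  by (induction A rule: infinite_finite_induct) (simp_all add: ring_map_one ring_map_mult)

lemma ring_map_power: "ring_map h \<Longrightarrow> h (x ^ n) = h x ^ n"
  by (induction n) (simp_all add: ring_map_one ring_map_mult)

lemmas ring_map_simps = ring_map_one ring_map_zero ring_map_add ring_map_diff ring_map_minus
  ring_map_mult ring_map_power ring_map_sum ring_map_prod

lemma ring_map_comp: "ring_map g \<Longrightarrow> ring_map h \<Longrightarrow> ring_map (\<lambda>x. g (h x))"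
  by (simp add: ring_map_def)

lemma ring_map_map_poly:
  assumes "ring_map h"
  shows "ring_map (map_poly h)"
  unfolding ring_map_def
  by (auto intro!: poly_eqI simp: coeff_map_poly coeff_mult ring_map_simps[OF assms])

lemma ring_map_poly: "ring_map (\<lambda>p. poly p x)"
  by (simp add: ring_map_def)

lemma ring_map_const_poly: "ring_map (\<lambda>c. [:c:])"
  by (simp add: ring_map_def)

lemma ring_map_eval2: "ring_map (eval2 x y)"
  by (simp add: ring_map_def)

text \<open>
  In \<open>k[x][y]\<close> the inner variable is \<open>x\<close> and the outer one is \<open>y\<close>: a polynomial \<open>P\<close> in one variable gives
  \<open>P(x)\<close> as the constant \<open>[:P:]\<close> and \<open>P(y)\<close> as \<open>const_y P\<close>.
\<close>

abbreviation const_y :: "'k::comm_ring_1 poly \<Rightarrow> 'k poly poly" where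
  "const_y \<equiv> map_poly (\<lambda>c. [:c:])"

lemma ring_map_const_y: "ring_map const_y"
  by (intro ring_map_map_poly ring_map_const_poly)

definition swap :: "'k::comm_ring_1 poly poly \<Rightarrow> 'k poly poly" where
  "swap g = poly (map_poly const_y g) [:[:0, 1:]:]"

lemma ring_map_swap: "ring_map swap"
  unfolding swap_def by (intro ring_map_comp[OF ring_map_poly] ring_map_map_poly ring_map_const_y)

lemma swap_pCons: "swap (pCons p g) = const_y p + [:[:0, 1:]:] * swap g"
  by (simp add: swap_def map_poly_pCons)

lemma swap_const [simp]: "swap [:P:] = const_y P"
  by (simp add: swap_def map_poly_pCons)

lemma coeff_swap [simp]: "coeff (coeff (swap g) d) c = coeff (coeff g c) d"
proof (induction g arbitrary: c)
  case 0
  then show ?case by (simp add: swap_def)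
next
  case (pCons p g)
  have "coeff (swap (pCons p g)) d = pCons (coeff p d) (coeff (swap g) d)"
    by (simp add: swap_pCons coeff_map_poly)
  then show ?case using pCons.IH by (simp add: coeff_pCons split: nat.split)
qed

lemma swap_swap [simp]: "swap (swap g) = g"
  by (intro poly_eqI) simp

lemma eval2_const_y [simp]: "eval2 x y (const_y p) = poly p y"
  by (induction p) (simp_all add: map_poly_pCons eval2_def)

lemma eval2_swap [simp]: "eval2 x y (swap g) = eval2 y x g"
proof (induction g)
  case 0
  then show ?case by (simp add: swap_def)
next
  case (pCons p g)
  have "eval2 y x (pCons p g) = poly p y + x * eval2 y x g"
    by (simp add: eval2_def)
  then show ?case using pCons.IH by (simp add: swap_pCons)
qed

lemma ring_map_ideal_gen_three:
  assumes "ring_map h" "x \<in> ideal_gen {a, b, c}"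
  shows "h x \<in> ideal_gen {h a, h b, h c}"
  using assms(2) unfolding ideal_gen_three_iff by (metis ring_map_simps(3,6)[OF assms(1)])

lemma elimination_y:
  fixes a b c :: "'k::alg_closed_field poly poly"
  assumes fin: "finite {(x, y). eval2 x y a = 0 \<and> eval2 x y b = 0 \<and> eval2 x y c = 0}"
  shows "\<exists>Q. Q \<noteq> 0 \<and> const_y Q \<in> ideal_gen {a, b, c}"
proof -
  have "{(x, y). eval2 x y (swap a) = 0 \<and> eval2 x y (swap b) = 0 \<and> eval2 x y (swap c) = 0} =
      prod.swap ` {(x, y). eval2 x y a = 0 \<and> eval2 x y b = 0 \<and> eval2 x y c = 0}"
    by (auto simp: image_iff)
  then have "finite {(x, y). eval2 x y (swap a) = 0 \<and> eval2 x y (swap b) = 0 \<and> eval2 x y (swap c) = 0}"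
    using fin by simp
  then obtain Q where Q: "Q \<noteq> 0" "[:Q:] \<in> ideal_gen {swap a, swap b, swap c}"
    using elimination_x by blast
  show ?thesis
    using ring_map_ideal_gen_three[OF ring_map_swap Q(2)] Q(1) by auto
qed

text \<open>
  The leading coefficient of \<open>Q(y)\<close> in \<open>y\<close> is a nonzero constant, so \<open>P(x)\<close> divides the leading
  coefficient of \<open>e\<close>; the induction removes the leading term.
\<close>

lemma const_x_dvd_const_y_mult:
  fixes P Q :: "'k::field poly"
  assumes "[:P:] dvd const_y Q * e" "Q \<noteq> 0"
  shows "[:P:] dvd e"
  using assms(1)
proof (induction "degree e" arbitrary: e rule: less_induct)
  case less
  define q where "q = const_y Q"
  have lq: "lead_coeff q = [:lead_coeff Q:]"
    unfolding q_def using assms(2) by (subst lead_coeff_map_poly_nz) auto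
  have "P dvd coeff (q * e) (degree q + degree e)"
    using less.prems const_poly_dvd_iff[of P "q * e"] by (auto simp: q_def)
  also have "\<dots> = smult (lead_coeff Q) (lead_coeff e)"
    unfolding coeff_mult_degree_sum lq by simp
  finally have lead: "P dvd lead_coeff e"
    using assms(2) by (simp add: dvd_smult_iff)
  define e' where "e' = e - monom (lead_coeff e) (degree e)"
  have dm: "[:P:] dvd monom (lead_coeff e) (degree e)"
    using lead by (simp add: const_poly_dvd_iff)
  have "[:P:] dvd e'"
  proof (cases "e' = 0")
    case False
    have "degree e' \<le> degree e"
      unfolding e'_def by (intro degree_diff_le order.refl degree_monom_le)
    moreover have "coeff e' (degree e) = 0" by (simp add: e'_def)
    ultimately have "degree e' < degree e"
      using False by (metis leading_coeff_0_iff le_neq_implies_less)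
    moreover have "[:P:] dvd const_y Q * e'"
      using less.prems dm by (simp add: e'_def algebra_simps)
    ultimately show ?thesis using less.hyps by blast
  qed simp
  then have "[:P:] dvd e' + monom (lead_coeff e) (degree e)" using dm by (rule dvd_add)
  then show ?case by (simp add: e'_def)
qed

text \<open>
  A vector proportional to \<open>(a, b, c)\<close> is a multiple of it if the ideal contains \<open>P(x)\<close> and \<open>Q(y)\<close>, because
  these are coprime: this is the part of the exactness of the Koszul complex that needs depth two.
  Multiplying \<open>v\<close> by \<open>H = f a + g b + h c\<close> gives \<open>H v = (f v1 + g v2 + h v3) (a, b, c)\<close>; comparing
  \<open>H = G P\<close> with \<open>H = G Q\<close> shows that \<open>P\<close> can be divided out. The factor \<open>G\<close> serves to work near a point
  at which \<open>G\<close> does not vanish, and the case \<open>c = 0\<close>, \<open>v3 = 0\<close> is the statement for two polynomials.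
\<close>

lemma proportional_up_to_factor:
  fixes a b c v1 v2 v3 G :: "'k::field poly poly"
  assumes P: "P \<noteq> 0" "G * [:P:] \<in> ideal_gen {a, b, c}"
    and Q: "Q \<noteq> 0" "G * const_y Q \<in> ideal_gen {a, b, c}"
    and v: "v1 * b = v2 * a" "v1 * c = v3 * a" "v2 * c = v3 * b"
  shows "\<exists>e. G * v1 = e * a \<and> G * v2 = e * b \<and> G * v3 = e * c"
proof (cases "a = 0 \<and> b = 0 \<and> c = 0")
  case True
  then have "G = 0" using P unfolding ideal_gen_three_iff by auto
  then show ?thesis by (intro exI[of _ 0]) simp
next
  case False
  have mult: "\<exists>e. H * v1 = e * a \<and> H * v2 = e * b \<and> H * v3 = e * c"
    if "H \<in> ideal_gen {a, b, c}" for H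
  proof -
    obtain f g h where "H = f * a + g * b + h * c" using \<open>H \<in> _\<close> by (auto simp: ideal_gen_three_iff)
    moreover have "(f * a + g * b + h * c) * v1 = (f * v1 + g * v2 + h * v3) * a"
        "(f * a + g * b + h * c) * v2 = (f * v1 + g * v2 + h * v3) * b"
        "(f * a + g * b + h * c) * v3 = (f * v1 + g * v2 + h * v3) * c"
      using v by algebra+
    ultimately show ?thesis by blast
  qed
  obtain e1 where e1: "G * [:P:] * v1 = e1 * a" "G * [:P:] * v2 = e1 * b" "G * [:P:] * v3 = e1 * c"
    using mult[OF P(2)] by blast
  obtain e2 where e2: "G * const_y Q * v1 = e2 * a" "G * const_y Q * v2 = e2 * b"
      "G * const_y Q * v3 = e2 * c"
    using mult[OF Q(2)] by blast
  have "const_y Q * e1 * a = [:P:] * e2 * a" "const_y Q * e1 * b = [:P:] * e2 * b"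
       "const_y Q * e1 * c = [:P:] * e2 * c"
    using e1 e2 by algebra+
  then have "const_y Q * e1 = [:P:] * e2" using False by (metis mult_right_cancel)
  then have "[:P:] dvd e1" using const_x_dvd_const_y_mult[OF _ Q(1)] by (metis dvd_triv_left)
  then obtain e where e: "e1 = [:P:] * e" by (elim dvdE)
  have "[:P:] * (G * v1) = [:P:] * (e * a)" "[:P:] * (G * v2) = [:P:] * (e * b)"
       "[:P:] * (G * v3) = [:P:] * (e * c)"
    using e1 unfolding e by algebra+
  then show ?thesis using P(1) by (metis mult_left_cancel pCons_eq_0_iff)
qed

definition koszul :: "'a::comm_ring_1 \<Rightarrow> 'a \<Rightarrow> 'a \<Rightarrow> 'a \<Rightarrow> 'a \<Rightarrow> 'a \<Rightarrow> bool" where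
  "koszul a b c A B C \<longleftrightarrow>
     (\<exists>h1 h2 h3. A = h1 * c + h2 * b \<and> B = - h2 * a + h3 * c \<and> C = - h1 * a - h3 * b)"

lemma koszulI:
  "A = h1 * c + h2 * b \<Longrightarrow> B = - h2 * a + h3 * c \<Longrightarrow> C = - h1 * a - h3 * b \<Longrightarrow> koszul a b c A B C"
  unfolding koszul_def by blast

lemma koszulE:
  assumes "koszul a b c A B C"
  obtains h1 h2 h3 where "A = h1 * c + h2 * b" "B = - h2 * a + h3 * c" "C = - h1 * a - h3 * b"
  using assms unfolding koszul_def by blast

lemma koszul_rotate:
  assumes "koszul b c a B C A"
  shows "koszul a b c A B C"
proof -
  obtain h1 h2 h3 where "B = h1 * a + h2 * c" "C = - h2 * b + h3 * a" "A = - h1 * b - h3 * c"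
    using assms by (rule koszulE)
  then show ?thesis
    by (intro koszulI[of _ "- h3" _ "- h1" _ _ _ h2]) (simp_all add: algebra_simps)
qed

lemma koszul_add:
  assumes "koszul a b c A B C" "koszul a b c A' B' C'"
  shows "koszul a b c (A + A') (B + B') (C + C')"
proof -
  obtain h1 h2 h3 where h: "A = h1 * c + h2 * b" "B = - h2 * a + h3 * c" "C = - h1 * a - h3 * b"
    using assms(1) by (rule koszulE)
  obtain g1 g2 g3
    where g: "A' = g1 * c + g2 * b" "B' = - g2 * a + g3 * c" "C' = - g1 * a - g3 * b"
    using assms(2) by (rule koszulE)
  show ?thesis unfolding h g
    by (intro koszulI[of _ "h1 + g1" _ "h2 + g2" _ _ _ "h3 + g3"]) (simp_all add: algebra_simps)
qed

lemma koszul_mult: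
  assumes "koszul a b c A B C"
  shows "koszul a b c (r * A) (r * B) (r * C)"
proof -
  obtain h1 h2 h3 where h: "A = h1 * c + h2 * b" "B = - h2 * a + h3 * c" "C = - h1 * a - h3 * b"
    using assms by (rule koszulE)
  show ?thesis unfolding h
    by (intro koszulI[of _ "r * h1" _ "r * h2" _ _ _ "r * h3"]) (simp_all add: algebra_simps)
qed

lemma koszul_ring_map:
  assumes "ring_map h" "koszul a b c A B C"
  shows "koszul (h a) (h b) (h c) (h A) (h B) (h C)"
  using assms(2) unfolding koszul_def by (metis ring_map_simps(3-6)[OF assms(1)])

lemma koszul_mult_last:
  assumes "A * a + B * b + C * c = (0 :: 'a::comm_ring_1)"
  shows "koszul a b c (c * A) (c * B) (c * C)"
proof -
  have "c * C = - A * a - B * b" using assms by (simp add: algebra_simps eq_neg_iff_add_eq_0)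
  then show ?thesis
    by (intro koszulI[of _ A _ 0 _ _ _ B]) (simp_all add: algebra_simps)
qed

text \<open>
  Hence every syzygy is Koszul wherever one of \<open>a\<close>, \<open>b\<close>, \<open>c\<close> is invertible.
\<close>

lemma koszul_mult_ideal:
  assumes syz: "A * a + B * b + C * c = (0 :: 'a::comm_ring_1)" and "f \<in> ideal_gen {a, b, c}"
  shows "koszul a b c (f * A) (f * B) (f * C)"
proof -
  obtain p q r where f: "f = p * a + q * b + r * c"
    using assms(2) by (auto simp: ideal_gen_three_iff)
  have c: "koszul a b c (c * A) (c * B) (c * C)"
    by (rule koszul_mult_last[OF syz])
  have a: "koszul a b c (a * A) (a * B) (a * C)"
    by (rule koszul_rotate, rule koszul_mult_last) (use syz in \<open>simp add: algebra_simps\<close>)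
  have b: "koszul a b c (b * A) (b * B) (b * C)"
    by (rule koszul_rotate, rule koszul_rotate, rule koszul_mult_last)
       (use syz in \<open>simp add: algebra_simps\<close>)
  have "koszul a b c (p * (a * A) + q * (b * A) + r * (c * A)) (p * (a * B) + q * (b * B) + r * (c * B))
      (p * (a * C) + q * (b * C) + r * (c * C))"
    by (intro koszul_add koszul_mult a b c)
  then show ?thesis by (simp add: f algebra_simps)
qed

text \<open>
  Where \<open>G3\<close> is invertible, \<open>c\<close> is a combination of \<open>a\<close> and \<open>b\<close>, and so is \<open>C\<close>, as it lies in the ideal.
  Adding multiples of two Koszul syzygies to \<open>(A, B, C)\<close> therefore makes its last entry vanish, and the
  remaining syzygy \<open>(U, V)\<close> of \<open>a\<close> and \<open>b\<close> is a multiple of \<open>(b, -a)\<close>. Each of these two steps costs one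
  factor \<open>G3\<close>.
\<close>

lemma koszul_of_syzygy_last:
  fixes a b c A B C :: "'k::field poly poly"
  assumes P: "P \<noteq> 0" "[:P:] \<in> ideal_gen {a, b, c}"
    and Q: "Q \<noteq> 0" "const_y Q \<in> ideal_gen {a, b, c}"
    and syz: "A * a + B * b + C * c = 0" and C: "C \<in> ideal_gen {a, b, c}"
    and G: "G1 * a + G2 * b + G3 * c = 0"
  shows "koszul a b c (G3^2 * A) (G3^2 * B) (G3^2 * C)"
proof -
  have G3: "\<exists>f g. G3 * H = f * a + g * b" if H: "H \<in> ideal_gen {a, b, c}" for H
  proof -
    obtain p q r where "H = p * a + q * b + r * c" using H by (auto simp: ideal_gen_three_iff)
    then have "G3 * H = (G3 * p - r * G1) * a + (G3 * q - r * G2) * b"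
      using G by algebra
    then show ?thesis by blast
  qed
  obtain p q where pq: "G3 * C = p * a + q * b" using G3[OF C] by blast
  define U where "U = G3 * A + p * c"
  define V where "V = G3 * B + q * c"
  have UV: "V * b = (- U) * a"
    unfolding U_def V_def using syz pq by algebra
  have "\<exists>e. G3 * V = e * a \<and> G3 * (- U) = e * b \<and> G3 * 0 = e * 0"
    using P Q UV
    by (intro proportional_up_to_factor[of P _ _ _ _ Q])
       (use G3[OF P(2)] G3[OF Q(2)] in \<open>auto simp: ideal_gen_three_iff\<close>)
  then obtain e where e: "G3 * V = e * a" "G3 * (- U) = e * b" by blast
  have "G3^2 * A = (- G3 * p) * c + (- e) * b" "G3^2 * B = - (- e) * a + (- G3 * q) * c"
       "G3^2 * C = - (- G3 * p) * a - (- G3 * q) * b"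
    using e pq unfolding U_def V_def by algebra+
  then show ?thesis unfolding koszul_def by blast
qed

lemma koszul_of_syzygy:
  fixes a b c A B C :: "'k::field poly poly"
  assumes P: "P \<noteq> 0" "[:P:] \<in> ideal_gen {a, b, c}"
    and Q: "Q \<noteq> 0" "const_y Q \<in> ideal_gen {a, b, c}"
    and syz: "A * a + B * b + C * c = 0"
    and ABC: "{A, B, C} \<subseteq> ideal_gen {a, b, c}"
    and G: "G1 * a + G2 * b + G3 * c = 0"
    and H: "H \<in> {G1, G2, G3}"
  shows "koszul a b c (H^2 * A) (H^2 * B) (H^2 * C)"
proof -
  have *: "{a, b, c} = {b, c, a}" "{a, b, c} = {c, a, b}" by auto
  have 3: "koszul a b c (G3^2 * A) (G3^2 * B) (G3^2 * C)"
    by (rule koszul_of_syzygy_last[OF P Q syz _ G]) (use ABC in auto)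
  have 1: "koszul b c a (G1^2 * B) (G1^2 * C) (G1^2 * A)"
    by (rule koszul_of_syzygy_last[where P = P and Q = Q and ?G1.0 = G2 and ?G2.0 = G3])
       (use ABC P Q syz G in \<open>auto simp flip: * simp: algebra_simps\<close>)
  have 2: "koszul c a b (G2^2 * C) (G2^2 * A) (G2^2 * B)"
    by (rule koszul_of_syzygy_last[where P = P and Q = Q and ?G1.0 = G3 and ?G2.0 = G1])
       (use ABC P Q syz G in \<open>auto simp flip: * simp: algebra_simps\<close>)
  show ?thesis
    using H 3 koszul_rotate[OF 1] koszul_rotate[OF koszul_rotate[OF 2]] by auto
qed

text \<open>
  If \<open>J\<close> together with any single linear polynomial \<open>y - \<beta>\<close> generates the unit ideal, the linear factors
  of \<open>Q\<close> can be cancelled one after the other within \<open>J\<close>.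
\<close>

lemma one_in_ideal_by_roots:
  fixes \<iota> :: "'k::alg_closed_field poly \<Rightarrow> 'a::comm_ring_1"
  assumes \<iota>: "ring_map \<iota>"
    and add: "\<And>f g. f \<in> J \<Longrightarrow> g \<in> J \<Longrightarrow> f + g \<in> J"
    and mult: "\<And>r f. f \<in> J \<Longrightarrow> r * f \<in> J"
    and Q: "\<iota> Q \<in> J" "Q \<noteq> 0"
    and roots: "\<And>\<beta>. \<exists>r. 1 + r * \<iota> [:-\<beta>, 1:] \<in> J"
  shows "1 \<in> J"
  using Q
proof (induction "degree Q" arbitrary: Q rule: less_induct)
  case less
  show ?case
  proof (cases "degree Q = 0")
    case True
    then obtain q where q: "Q = [:q:]" by (elim degree_eq_zeroE)
    have "\<iota> [:inverse q:] * \<iota> Q = 1"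
      using less.prems q by (simp flip: ring_map_mult[OF \<iota>] add: ring_map_one[OF \<iota>] one_pCons[symmetric])
    then show ?thesis using mult[OF less.prems(1)] by metis
  next
    case False
    then obtain \<beta> where "poly Q \<beta> = 0" using alg_closed_imp_poly_has_root by blast
    then obtain Q' where Q': "Q = [:-\<beta>, 1:] * Q'" by (auto simp: poly_eq_0_iff_dvd elim: dvdE)
    obtain r where r: "1 + r * \<iota> [:-\<beta>, 1:] \<in> J" using roots by blast
    have "\<iota> Q' * (1 + r * \<iota> [:-\<beta>, 1:]) + (- r) * \<iota> Q \<in> J"
      by (intro add mult r less.prems)
    also have "\<iota> Q' * (1 + r * \<iota> [:-\<beta>, 1:]) + (- r) * \<iota> Q = \<iota> Q'"
      unfolding Q' ring_map_mult[OF \<iota>] by (simp add: algebra_simps)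
    finally have "\<iota> Q' \<in> J" .
    moreover have "Q' \<noteq> 0" using less.prems Q' by auto
    moreover have "degree Q' < degree Q"
      unfolding Q' using \<open>Q' \<noteq> 0\<close> by (subst degree_mult_eq) auto
    ultimately show ?thesis using less.hyps by blast
  qed
qed

lemma eval2_decomp:
  fixes g :: "'k::field poly poly"
  shows "\<exists>r r'. g = [:[:eval2 x y g:]:] + r * const_y [:-y, 1:] + r' * [:[:-x, 1:]:]"
proof -
  have "poly (g - [:poly g [:y:]:]) [:y:] = 0" by simp
  then obtain r where r: "g - [:poly g [:y:]:] = [:-[:y:], 1:] * r"
    unfolding poly_eq_0_iff_dvd by (elim dvdE)
  have "poly (poly g [:y:] - [:eval2 x y g:]) x = 0" by (simp add: eval2_def)
  then obtain r' where r': "poly g [:y:] - [:eval2 x y g:] = [:-x, 1:] * r'"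
    unfolding poly_eq_0_iff_dvd by (elim dvdE)
  have c: "const_y [:-y, 1:] = [:-[:y:], 1:]"
    by (simp add: map_poly_pCons one_pCons)
  have "g = [:poly g [:y:]:] + r * const_y [:-y, 1:]"
    using r unfolding c by (metis add.commute diff_eq_eq mult.commute)
  also have "[:poly g [:y:]:] = [:[:eval2 x y g:] + [:-x, 1:] * r':]"
    using r' by (metis add.commute diff_eq_eq)
  also have "\<dots> = [:[:eval2 x y g:]:] + [:r':] * [:[:-x, 1:]:]"
    by simp
  finally have "g = [:[:eval2 x y g:]:] + [:r':] * [:[:-x, 1:]:] + r * const_y [:-y, 1:]" .
  then have "g = [:[:eval2 x y g:]:] + r * const_y [:-y, 1:] + [:r':] * [:[:-x, 1:]:]"
    by (simp only: ac_simps)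
  then show ?thesis by blast
qed

text \<open>
  The weak Nullstellensatz for ideals that contain a nonzero polynomial in each of the variables. The
  ideal \<open>K\<close> in the proof is \<open>J\<close> enlarged by the equation of a vertical line.
\<close>

lemma one_in_ideal_bivariate:
  fixes J :: "'k::alg_closed_field poly poly set"
  assumes add: "\<And>f g. f \<in> J \<Longrightarrow> g \<in> J \<Longrightarrow> f + g \<in> J"
    and mult: "\<And>r f. f \<in> J \<Longrightarrow> r * f \<in> J"
    and P: "P \<noteq> 0" "[:P:] \<in> J" and Q: "Q \<noteq> 0" "const_y Q \<in> J"
    and nz: "\<And>x y. \<exists>g \<in> J. eval2 x y g \<noteq> 0"
  shows "1 \<in> J"
proof (rule one_in_ideal_by_roots[OF ring_map_const_poly add mult P(2,1)])
  fix x
  define K where "K = {f. \<exists>r. f + r * [:[:-x, 1:]:] \<in> J}"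
  have "1 \<in> K"
  proof (rule one_in_ideal_by_roots[OF ring_map_const_y _ _ _ Q(1)])
    show "f + g \<in> K" if "f \<in> K" "g \<in> K" for f g
    proof -
      from that obtain r r' where "f + r * [:[:-x, 1:]:] \<in> J" "g + r' * [:[:-x, 1:]:] \<in> J"
        by (auto simp: K_def)
      from add[OF this] have "f + g + (r + r') * [:[:-x, 1:]:] \<in> J"
        by (simp only: distrib_right ac_simps)
      then show ?thesis unfolding K_def by blast
    qed
    show "s * f \<in> K" if "f \<in> K" for s f
    proof -
      from that obtain r where "f + r * [:[:-x, 1:]:] \<in> J" by (auto simp: K_def)
      from mult[OF this, of s] have "s * f + (s * r) * [:[:-x, 1:]:] \<in> J"
        by (simp only: distrib_left ac_simps)
      then show ?thesis unfolding K_def by blast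
    qed
    show "const_y Q \<in> K" unfolding K_def using Q(2) by (intro CollectI exI[of _ 0]) simp
    show "\<exists>r. 1 + r * const_y [:-y, 1:] \<in> K" for y
    proof -
      obtain g where g: "g \<in> J" "eval2 x y g \<noteq> 0" using nz by blast
      obtain r r' where r: "g = [:[:eval2 x y g:]:] + r * const_y [:-y, 1:] + r' * [:[:-x, 1:]:]"
        using eval2_decomp by blast
      define i where "i = [:[:inverse (eval2 x y g):]:]"
      have "i * g \<in> J" by (rule mult[OF g(1)])
      also have "i * g = i * [:[:eval2 x y g:]:] + (i * r) * const_y [:-y, 1:] + (i * r') * [:[:-x, 1:]:]"
        by (subst r) (simp only: algebra_simps)
      also have "i * [:[:eval2 x y g:]:] = 1" using g(2) by (simp add: i_def one_pCons)
      finally show ?thesis unfolding K_def by blast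
    qed
  qed
  then show "\<exists>r. 1 + r * [:[:-x, 1:]:] \<in> J" by (simp add: K_def)
qed

section \<open>Descent from power series to polynomials\<close>

definition to_series :: "'k::field poly poly \<Rightarrow> 'k fps fps" where
  "to_series g = fps_of_poly (map_poly fps_of_poly g)"

lemma ring_map_fps_of_poly: "ring_map fps_of_poly"
  by (simp add: ring_map_def fps_of_poly_add fps_of_poly_mult)

lemma ring_map_to_series: "ring_map to_series"
  unfolding to_series_def by (intro ring_map_comp[OF ring_map_fps_of_poly] ring_map_map_poly ring_map_fps_of_poly)

lemma to_series_nth [simp]: "fps_nth (fps_nth (to_series g) d) c = coeff (coeff g d) c"
  by (simp add: to_series_def coeff_map_poly)

lemma to_series_const: "to_series [:[:c:]:] = ser_const c"
  by (simp add: to_series_def ser_const_def map_poly_pCons fps_of_poly_const)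

lemma to_series_x: "to_series [:[:0, 1:]:] = ser_X"
  by (simp add: to_series_def ser_X_def map_poly_pCons fps_of_poly_const fps_of_poly_pCons)

lemma to_series_y: "to_series [:0, 1:] = ser_Y"
  by (simp add: to_series_def ser_Y_def map_poly_pCons fps_of_poly_pCons)

text \<open>
  Membership in the ideal \<open>\<langle>X^N, Y^N\<rangle>\<close> of power series, expressed by coefficients so that it can be
  compared with polynomials.
\<close>

definition in_pow_ideal :: "nat \<Rightarrow> 'k::field fps fps \<Rightarrow> bool" where
  "in_pow_ideal N F \<longleftrightarrow> (\<forall>d<N. \<forall>c<N. fps_nth (fps_nth F d) c = 0)"

lemma in_pow_ideal_add: "in_pow_ideal N F \<Longrightarrow> in_pow_ideal N G \<Longrightarrow> in_pow_ideal N (F + G)"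
  by (simp add: in_pow_ideal_def)

lemma in_pow_ideal_mult: "in_pow_ideal N F \<Longrightarrow> in_pow_ideal N (F * G)"
  by (simp add: in_pow_ideal_def fps_mult_nth fps_sum_nth)

lemma truncation:
  fixes F :: "'k::field fps fps"
  assumes "N > 0"
  shows "\<exists>f. in_pow_ideal N (F - to_series f) \<and> coeff (coeff f 0) 0 = fps_nth (fps_nth F 0) 0"
proof -
  define f where "f = Poly (map (\<lambda>d. Poly (map (fps_nth (fps_nth F d)) [0..<N])) [0..<N])"
  have "coeff (coeff f d) c = fps_nth (fps_nth F d) c" if "d < N" "c < N" for d c
    using that by (simp add: f_def nth_default_def)
  then show ?thesis using assms by (intro exI[of _ f]) (simp add: in_pow_ideal_def)
qed

text \<open>
  The ideal \<open>\<langle>X^N, Y^N\<rangle>\<close> of power series contracts to the ideal \<open>\<langle>x^N, y^N\<rangle>\<close> of polynomials.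
\<close>

lemma in_pow_ideal_to_seriesD:
  fixes g :: "'k::field poly poly"
  assumes "in_pow_ideal N (to_series g)"
  shows "\<exists>g1 g2. g = [:monom 1 N:] * g1 + monom 1 N * g2"
proof -
  have "monom 1 N dvd g - poly_cutoff N g"
    unfolding monom_1_dvd_iff' by (simp add: coeff_poly_cutoff)
  then obtain g2 where g2: "g - poly_cutoff N g = monom 1 N * g2" by (elim dvdE)
  have "monom 1 N dvd coeff (poly_cutoff N g) d" for d
    using assms unfolding monom_1_dvd_iff' by (auto simp: coeff_poly_cutoff in_pow_ideal_def)
  then have "[:monom 1 N:] dvd poly_cutoff N g" unfolding const_poly_dvd_iff by blast
  then obtain g1 where "poly_cutoff N g = [:monom 1 N:] * g1" by (elim dvdE)
  then show ?thesis using g2 by (metis add.commute diff_eq_eq)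
qed

text \<open>
  Three vectors \<open>(f, g)\<close> of a plane are linearly dependent; their cross product is a relation unless it
  vanishes.
\<close>

lemma exists_orthogonal:
  fixes f1 f2 f3 g1 g2 g3 :: "'k::field"
  shows "\<exists>l1 l2 l3. (l1 \<noteq> 0 \<or> l2 \<noteq> 0 \<or> l3 \<noteq> 0) \<and>
    l1 * f1 + l2 * f2 + l3 * f3 = 0 \<and> l1 * g1 + l2 * g2 + l3 * g3 = 0"
proof (cases "f2 * g3 = f3 * g2 \<and> f3 * g1 = f1 * g3 \<and> f1 * g2 = f2 * g1")
  case False
  then show ?thesis
    by - (rule exI[of _ "f2 * g3 - f3 * g2"], rule exI[of _ "f3 * g1 - f1 * g3"],
          rule exI[of _ "f1 * g2 - f2 * g1"], auto simp: algebra_simps)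
next
  case True
  consider "f1 \<noteq> 0 \<or> f2 \<noteq> 0" | "f2 \<noteq> 0 \<or> f3 \<noteq> 0" | "g1 \<noteq> 0 \<or> g2 \<noteq> 0" "f1 = 0" "f2 = 0" "f3 = 0"
    | "g1 = 0" "g2 = 0" "f1 = 0" "f2 = 0" "f3 = 0" by blast
  then show ?thesis
  proof cases
    case 1
    then show ?thesis using True
      by - (rule exI[of _ "- f2"], rule exI[of _ f1], rule exI[of _ 0], auto)
  next
    case 2
    then show ?thesis using True
      by - (rule exI[of _ 0], rule exI[of _ "- f3"], rule exI[of _ f2], auto)
  next
    case 3
    then show ?thesis using True
      by - (rule exI[of _ "- g2"], rule exI[of _ g1], rule exI[of _ 0], auto)
  next
    case 4
    then show ?thesis by - (rule exI[of _ 1], rule exI[of _ 0], rule exI[of _ 0], auto)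
  qed
qed

lemma ring_map_constant_term: "ring_map (\<lambda>F. fps_nth (fps_nth F 0) 0)"
  by (simp add: ring_map_def)

lemma constant_term_ser_const [simp]: "fps_nth (fps_nth (ser_const c) 0) 0 = c"
  by (simp add: ser_const_def)

text \<open>
  This is how curvilinearity enters: an ideal \<open>\<langle>x, y^r\<rangle>\<close> has two generators. The constant terms of the
  coefficients that express \<open>a\<close>, \<open>b\<close>, \<open>c\<close> through two generators are three vectors of a plane, so some
  nontrivial combination of \<open>a\<close>, \<open>b\<close>, \<open>c\<close> with constant coefficients lies in the product of the ideal with
  the maximal ideal.
\<close>

lemma relation_of_two_generators:
  fixes a b c x z :: "'k::field fps fps"
  assumes "ideal_gen {a, b, c} = ideal_gen {x, z}"
  shows "\<exists>l1 l2 l3 F1 F2 F3. (l1 \<noteq> 0 \<or> l2 \<noteq> 0 \<or> l3 \<noteq> 0) \<and>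
    fps_nth (fps_nth F1 0) 0 = 0 \<and> fps_nth (fps_nth F2 0) 0 = 0 \<and> fps_nth (fps_nth F3 0) 0 = 0 \<and>
    ser_const l1 * a + ser_const l2 * b + ser_const l3 * c = F1 * a + F2 * b + F3 * c"
proof -
  have "a \<in> ideal_gen {x, z}" "b \<in> ideal_gen {x, z}" "c \<in> ideal_gen {x, z}"
    using assms ideal_gen_base[of _ "{a, b, c}"] by auto
  then obtain fa ga fb gb fc gc
    where abc: "a = fa * x + ga * z" "b = fb * x + gb * z" "c = fc * x + gc * z"
    unfolding ideal_gen_two_iff by blast
  have "x \<in> ideal_gen {a, b, c}" "z \<in> ideal_gen {a, b, c}"
    using assms ideal_gen_base[of _ "{x, z}"] by auto
  then obtain x1 x2 x3 z1 z2 z3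
    where xz: "x = x1 * a + x2 * b + x3 * c" "z = z1 * a + z2 * b + z3 * c"
    unfolding ideal_gen_three_iff by blast
  define e where "e F = fps_nth (fps_nth F 0) 0" for F :: "'k fps fps"
  have e: "ring_map e" unfolding e_def by (rule ring_map_constant_term)
  obtain l1 l2 l3 where l: "l1 \<noteq> 0 \<or> l2 \<noteq> 0 \<or> l3 \<noteq> 0"
    "l1 * e fa + l2 * e fb + l3 * e fc = 0" "l1 * e ga + l2 * e gb + l3 * e gc = 0"
    using exists_orthogonal by blast
  define s where "s = ser_const l1 * fa + ser_const l2 * fb + ser_const l3 * fc"
  define t where "t = ser_const l1 * ga + ser_const l2 * gb + ser_const l3 * gc"
  have ec: "e (ser_const r) = r" for r by (simp add: e_def)
  have st: "e s = 0" "e t = 0"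
    unfolding s_def t_def by (simp_all add: ring_map_simps[OF e] ec l)
  have "ser_const l1 * a + ser_const l2 * b + ser_const l3 * c = s * x + t * z"
    unfolding abc s_def t_def by (simp add: algebra_simps)
  also have "\<dots> = s * (x1 * a + x2 * b + x3 * c) + t * (z1 * a + z2 * b + z3 * c)"
    using xz by metis
  also have "\<dots> = (s * x1 + t * z1) * a + (s * x2 + t * z2) * b + (s * x3 + t * z3) * c"
    by (simp add: algebra_simps)
  finally show ?thesis
    using l(1) st
    by - (rule exI[of _ l1], rule exI[of _ l2], rule exI[of _ l3],
        rule exI[of _ "s * x1 + t * z1"], rule exI[of _ "s * x2 + t * z2"],
        rule exI[of _ "s * x3 + t * z3"], simp flip: e_def add: ring_map_simps[OF e])
qed

lemma factor_out_x:
  fixes P :: "'k::field poly"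
  assumes "P \<noteq> 0"
  obtains i P1 where "P = [:0, 1:] ^ i * P1" "poly P1 0 \<noteq> 0"
  using order_decomp[OF assms, of 0] by (auto simp: poly_eq_0_iff_dvd)

text \<open>
  A power series relation as above implies a polynomial one, whose coefficients at the origin are still
  not all zero. Up to the factors \<open>P1(x)\<close> and \<open>Q1(y)\<close>, which do not vanish at the origin, the ideal contains
  \<open>x^i\<close> and \<open>y^j\<close>. Replacing \<open>F1\<close>, \<open>F2\<close>, \<open>F3\<close> by truncations changes the relation by an element of
  \<open>\<langle>x^N, y^N\<rangle>\<close>, which for \<open>N > i, j\<close> and up to these factors lies in the product of the ideal with the
  maximal ideal, so that the change can be absorbed into coefficients that vanish at the origin.
\<close>

lemma syzygy_of_relation:
  fixes a b c :: "'k::field poly poly"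
  assumes P: "P \<noteq> 0" "[:P:] \<in> ideal_gen {a, b, c}"
    and Q: "Q \<noteq> 0" "const_y Q \<in> ideal_gen {a, b, c}"
    and l: "l1 \<noteq> 0 \<or> l2 \<noteq> 0 \<or> l3 \<noteq> 0"
    and F: "fps_nth (fps_nth F1 0) 0 = 0" "fps_nth (fps_nth F2 0) 0 = 0" "fps_nth (fps_nth F3 0) 0 = 0"
    and rel: "ser_const l1 * to_series a + ser_const l2 * to_series b + ser_const l3 * to_series c =
      F1 * to_series a + F2 * to_series b + F3 * to_series c"
  shows "\<exists>G1 G2 G3. G1 * a + G2 * b + G3 * c = 0 \<and>
    (eval2 0 0 G1 \<noteq> 0 \<or> eval2 0 0 G2 \<noteq> 0 \<or> eval2 0 0 G3 \<noteq> 0)"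
proof -
  obtain i P1 where P1: "P = [:0, 1:] ^ i * P1" "poly P1 0 \<noteq> 0" using factor_out_x[OF P(1)] .
  obtain j Q1 where Q1: "Q = [:0, 1:] ^ j * Q1" "poly Q1 0 \<noteq> 0" using factor_out_x[OF Q(1)] .
  \<comment> \<open>One more than needed for \<open>x^i\<close> and \<open>y^j\<close>: the extra factor makes the coefficients vanish at the origin.\<close>
  define N where "N = Suc (i + j)"
  have N: "N > 0" by (simp add: N_def)
  obtain f1 f2 f3 where f: "in_pow_ideal N (F1 - to_series f1)" "in_pow_ideal N (F2 - to_series f2)"
      "in_pow_ideal N (F3 - to_series f3)"
    and f0: "coeff (coeff f1 0) 0 = 0" "coeff (coeff f2 0) 0 = 0" "coeff (coeff f3 0) 0 = 0"
    using truncation[OF N] F by metis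
  define d where "d = ([:[:l1:]:] - f1) * a + ([:[:l2:]:] - f2) * b + ([:[:l3:]:] - f3) * c"
  have "to_series d = (F1 - to_series f1) * to_series a + (F2 - to_series f2) * to_series b + (F3 - to_series f3) * to_series c"
    unfolding d_def ring_map_simps[OF ring_map_to_series] to_series_const left_diff_distrib
    using rel by (simp add: algebra_simps)
  moreover have "in_pow_ideal N \<dots>"
    by (intro in_pow_ideal_add in_pow_ideal_mult f)
  ultimately obtain g1 g2 where d: "d = [:monom 1 N:] * g1 + monom 1 N * g2"
    using in_pow_ideal_to_seriesD by metis
  define X :: "'k poly poly" where "X = [:[:0, 1:]:]"
  define Y :: "'k poly poly" where "Y = [:0, 1:]"
  have cP: "[:P:] = X ^ i * [:P1:]"
    unfolding P1(1) X_def by (simp add: ring_map_simps[OF ring_map_const_poly])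
  have "const_y [:0, 1:] = Y" by (simp add: map_poly_pCons Y_def one_pCons)
  then have cQ: "const_y Q = Y ^ j * const_y Q1"
    unfolding Q1(1) by (simp add: ring_map_simps[OF ring_map_const_y])
  have XN: "[:monom 1 N:] = X * X ^ j * X ^ i"
    unfolding X_def N_def monom_altdef
    by (simp add: ring_map_simps[OF ring_map_const_poly] power_add mult_ac flip: ring_map_power[OF ring_map_const_poly])
  have YN: "monom 1 N = Y * Y ^ i * Y ^ j"
    unfolding Y_def N_def monom_altdef by (simp add: power_add mult_ac)
  obtain p1 p2 p3 where p: "[:P:] = p1 * a + p2 * b + p3 * c"
    using P(2) unfolding ideal_gen_three_iff by blast
  obtain q1 q2 q3 where q: "const_y Q = q1 * a + q2 * b + q3 * c"
    using Q(2) unfolding ideal_gen_three_iff by blast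
  define u where "u = const_y Q1 * X ^ j * g1"
  define v where "v = [:P1:] * Y ^ i * g2"
  define G where "G l f p' q' = [:P1:] * const_y Q1 * ([:[:l:]:] - f) - X * u * p' - Y * v * q'"
    for l f p' q'
  have "[:P1:] * const_y Q1 * d = X * u * [:P:] + Y * v * const_y Q"
    unfolding d XN YN cP cQ u_def v_def by (simp only: algebra_simps)
  also have "\<dots> = X * u * (p1 * a + p2 * b + p3 * c) + Y * v * (q1 * a + q2 * b + q3 * c)"
    unfolding p q ..
  finally have "G l1 f1 p1 q1 * a + G l2 f2 p2 q2 * b + G l3 f3 p3 q3 * c = 0"
    unfolding G_def d_def by algebra
  moreover have "eval2 0 0 X = 0" "eval2 0 0 Y = 0" "eval2 0 0 f = coeff (coeff f 0) 0" for f :: "'k poly poly"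
    by (simp_all add: X_def Y_def eval2_def poly_0_coeff_0)
  then have "eval2 0 0 (G l f p' q') = poly P1 0 * poly Q1 0 * (l - coeff (coeff f 0) 0)" for l f p' q'
    unfolding G_def by simp
  ultimately show ?thesis
    using l P1(2) Q1(2) f0
    by - (rule exI[of _ "G l1 f1 p1 q1"], rule exI[of _ "G l2 f2 p2 q2"],
        rule exI[of _ "G l3 f3 p3 q3"], auto)
qed

section \<open>Substitution homomorphisms\<close>

lemma poly_mapping_sum_singles: "f = (\<Sum>e\<in>Poly_Mapping.keys f. Poly_Mapping.single e (Poly_Mapping.lookup f e))"
  by (rule poly_mapping_eqI) (auto simp: lookup_sum lookup_single when_def in_keys_iff)

definition monomial_value :: "(var \<Rightarrow> 'r::comm_ring_1) \<Rightarrow> (var \<Rightarrow>\<^sub>0 nat) \<Rightarrow> 'r" where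
  "monomial_value \<phi> e = (\<Prod>x\<in>{VS, VU, VT, VV}. \<phi> x ^ Poly_Mapping.lookup e x)"

lemma monomial_value_add: "monomial_value \<phi> (e + e') = monomial_value \<phi> e * monomial_value \<phi> e'"
  by (simp add: monomial_value_def lookup_add power_add prod.distrib mult_ac)

lemma monomial_value_expand: "monomial_value \<phi> e =
    \<phi> VS ^ Poly_Mapping.lookup e VS * \<phi> VU ^ Poly_Mapping.lookup e VU *
    (\<phi> VT ^ Poly_Mapping.lookup e VT * \<phi> VV ^ Poly_Mapping.lookup e VV)"
  by (simp add: monomial_value_def mult_ac)

lemma poly_subst_alt:
  "poly_subst \<iota> \<phi> f = (\<Sum>e\<in>Poly_Mapping.keys f. \<iota> (Poly_Mapping.lookup f e) * monomial_value \<phi> e)"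
  by (simp only: poly_subst_def monomial_value_def)

lemma poly_subst_superset:
  assumes "ring_map \<iota>" "finite S" "Poly_Mapping.keys f \<subseteq> S"
  shows "poly_subst \<iota> \<phi> f = (\<Sum>e\<in>S. \<iota> (Poly_Mapping.lookup f e) * monomial_value \<phi> e)"
  unfolding poly_subst_alt
  by (rule sum.mono_neutral_left) (use assms in \<open>auto simp: in_keys_iff ring_map_zero\<close>)

lemma poly_subst_add:
  assumes "ring_map \<iota>"
  shows "poly_subst \<iota> \<phi> (f + g) = poly_subst \<iota> \<phi> f + poly_subst \<iota> \<phi> g"
proof -
  define S where "S = Poly_Mapping.keys f \<union> Poly_Mapping.keys g"
  have S: "finite S" "Poly_Mapping.keys f \<subseteq> S" "Poly_Mapping.keys g \<subseteq> S" "Poly_Mapping.keys (f + g) \<subseteq> S"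
    using Poly_Mapping.keys_add[of f g] by (auto simp: S_def)
  show ?thesis
    unfolding poly_subst_superset[OF assms S(1,2)] poly_subst_superset[OF assms S(1,3)]
      poly_subst_superset[OF assms S(1,4)]
    by (simp add: lookup_add ring_map_add[OF assms] distrib_right sum.distrib)
qed

lemma poly_subst_single:
  assumes "ring_map \<iota>"
  shows "poly_subst \<iota> \<phi> (Poly_Mapping.single e c) = \<iota> c * monomial_value \<phi> e"
  by (subst poly_subst_superset[OF assms, of "{e}"]) auto

lemma poly_subst_sum:
  assumes "ring_map \<iota>"
  shows "poly_subst \<iota> \<phi> (sum F A) = (\<Sum>i\<in>A. poly_subst \<iota> \<phi> (F i))"
  by (induction A rule: infinite_finite_induct)
     (simp_all add: poly_subst_add[OF assms], simp_all add: poly_subst_def)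

lemma ring_map_poly_subst:
  assumes "ring_map \<iota>"
  shows "ring_map (poly_subst \<iota> \<phi>)"
  unfolding ring_map_def
proof (intro conjI allI)
  show "poly_subst \<iota> \<phi> 1 = 1"
    using poly_subst_single[OF assms, of \<phi> 0 1]
    by (simp add: ring_map_one[OF assms] monomial_value_def)
  show "poly_subst \<iota> \<phi> (f + g) = poly_subst \<iota> \<phi> f + poly_subst \<iota> \<phi> g" for f g
    by (rule poly_subst_add[OF assms])
  show "poly_subst \<iota> \<phi> (f * g) = poly_subst \<iota> \<phi> f * poly_subst \<iota> \<phi> g" for f g
  proof -
    have "f * g = (\<Sum>e\<in>Poly_Mapping.keys f. \<Sum>e'\<in>Poly_Mapping.keys g.
        Poly_Mapping.single (e + e') (Poly_Mapping.lookup f e * Poly_Mapping.lookup g e'))"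
      by (subst (1) poly_mapping_sum_singles[of f], subst (1) poly_mapping_sum_singles[of g])
         (simp add: sum_product mult_single)
    then show ?thesis
      by (simp add: poly_subst_sum[OF assms] poly_subst_single[OF assms] ring_map_mult[OF assms]
          monomial_value_add poly_subst_alt[of _ _ f] poly_subst_alt[of _ _ g] sum_product mult_ac)
  qed
qed

lemma poly_subst_X_of [simp]:
  assumes "ring_map \<iota>"
  shows "poly_subst \<iota> \<phi> (X_of x) = \<phi> x"
  unfolding X_of_def poly_subst_single[OF assms]
  by (cases x) (simp_all add: ring_map_one[OF assms] monomial_value_expand lookup_single)

lemma ring_map_apply_poly_subst:
  assumes "ring_map h"
  shows "h (poly_subst \<iota> \<phi> f) = poly_subst (\<lambda>c. h (\<iota> c)) (\<lambda>x. h (\<phi> x)) f"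
  unfolding poly_subst_def by (simp only: ring_map_simps[OF assms])

text \<open>
  The affine chart of the product of two projective lines around a point \<open>(p, q)\<close> uses the same
  coordinates as the Taylor expansion \<open>germ p q\<close>, but with values in the polynomial ring.
\<close>

definition chart_coords :: "'k::field \<times> 'k \<Rightarrow> 'k poly poly \<Rightarrow> 'k poly poly \<times> 'k poly poly" where
  "chart_coords p z = (if fst p \<noteq> 0 then (1, [:[:snd p / fst p:]:] + z) else (z, 1))"

definition chart :: "'k::field \<times> 'k \<Rightarrow> 'k \<times> 'k \<Rightarrow> 'k bipoly \<Rightarrow> 'k poly poly" where
  "chart p q = poly_subst (\<lambda>c. [:[:c:]:]) (coords (chart_coords p [:[:0, 1:]:]) (chart_coords q [:0, 1:]))"

definition chart_point :: "'k::field \<times> 'k \<Rightarrow> 'k \<Rightarrow> 'k \<times> 'k" where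
  "chart_point p x = (if fst p \<noteq> 0 then (1, snd p / fst p + x) else (x, 1))"

abbreviation value_at :: "'k::field \<times> 'k \<Rightarrow> 'k \<times> 'k \<Rightarrow> 'k bipoly \<Rightarrow> 'k" where
  "value_at p q \<equiv> poly_subst id (coords p q)"

lemma ring_map_const_const: "ring_map (\<lambda>c. [:[:c:]:])"
  by (intro ring_map_comp[OF ring_map_const_poly] ring_map_const_poly)

lemma ring_map_chart: "ring_map (chart p q)"
  unfolding chart_def by (intro ring_map_poly_subst ring_map_const_const)

lemma to_series_chart: "to_series (chart p q f) = germ p q f"
  unfolding chart_def germ_def ring_map_apply_poly_subst[OF ring_map_to_series] to_series_const
proof (rule arg_cong[where f = "\<lambda>\<phi>. poly_subst ser_const \<phi> f"], rule ext)
  show "to_series (coords (chart_coords p [:[:0, 1:]:]) (chart_coords q [:0, 1:]) z) =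
      coords (taylor_coords p ser_X) (taylor_coords q ser_Y) z" for z
    by (cases z; cases "fst p = 0"; cases "fst q = 0")
       (simp_all add: chart_coords_def taylor_coords_def ring_map_simps[OF ring_map_to_series]
         to_series_const to_series_x to_series_y del: add_pCons)
qed

lemma eval2_chart: "eval2 x y (chart p q f) = value_at (chart_point p x) (chart_point q y) f"
  unfolding chart_def ring_map_apply_poly_subst[OF ring_map_eval2]
proof -
  have "(\<lambda>z. eval2 x y (coords (chart_coords p [:[:0, 1:]:]) (chart_coords q [:0, 1:]) z)) =
      coords (chart_point p x) (chart_point q y)"
  proof
    show "eval2 x y (coords (chart_coords p [:[:0, 1:]:]) (chart_coords q [:0, 1:]) z) =
        coords (chart_point p x) (chart_point q y) z" for z
      by (cases z; cases "fst p = 0"; cases "fst q = 0")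
         (simp_all add: chart_coords_def chart_point_def eval2_def)
  qed
  then show "poly_subst (\<lambda>c. eval2 x y [:[:c:]:])
      (\<lambda>z. eval2 x y (coords (chart_coords p [:[:0, 1:]:]) (chart_coords q [:0, 1:]) z)) f =
      value_at (chart_point p x) (chart_point q y) f"
    by (simp add: id_def)
qed

lemma ring_map_germ: "ring_map (germ p q)"
  using ring_map_comp[OF ring_map_to_series ring_map_chart] by (simp add: to_series_chart)

section \<open>Bihomogeneous polynomials\<close>

lemma bihomogeneous_0 [simp]: "bihomogeneous i j 0"
  by (simp add: bihomogeneous_def)

lemma bihomogeneous_add: "bihomogeneous i j f \<Longrightarrow> bihomogeneous i j g \<Longrightarrow> bihomogeneous i j (f + g)"
  using Poly_Mapping.keys_add[of f g] unfolding bihomogeneous_def by blast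

lemma bihomogeneous_uminus: "bihomogeneous i j f \<Longrightarrow> bihomogeneous i j (- f)"
  by (simp add: bihomogeneous_def)

lemma bihomogeneous_diff: "bihomogeneous i j f \<Longrightarrow> bihomogeneous i j g \<Longrightarrow> bihomogeneous i j (f - g)"
  using bihomogeneous_add[of i j f "- g"] bihomogeneous_uminus[of i j g] by simp

lemma bihomogeneous_mult:
  assumes "bihomogeneous i j f" "bihomogeneous i' j' g" "i'' = i + i'" "j'' = j + j'"
  shows "bihomogeneous i'' j'' (f * g)"
  using Poly_Mapping.keys_mult[of f g] assms unfolding bihomogeneous_def
  by (fastforce simp: lookup_add)

lemma bihomogeneous_sum:
  "(\<And>x. x \<in> S \<Longrightarrow> bihomogeneous i j (F x)) \<Longrightarrow> bihomogeneous i j (sum F S)"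
  by (induction S rule: infinite_finite_induct) (auto intro: bihomogeneous_add)

abbreviation const :: "'k::comm_ring_1 \<Rightarrow> 'k bipoly" where
  "const c \<equiv> Poly_Mapping.single 0 c"

lemma bihomogeneous_const: "bihomogeneous 0 0 (const c)"
  by (simp add: bihomogeneous_def)

lemma bihomogeneous_X_of:
  "bihomogeneous (if x \<in> {VS, VU} then 1 else 0) (if x \<in> {VS, VU} then 0 else 1) (X_of x :: 'k::comm_ring_1 bipoly)"
  by (cases x) (auto simp: bihomogeneous_def X_of_def lookup_single)

lemma bihomogeneous_power:
  assumes "bihomogeneous i j f" "i' = int n * i" "j' = int n * j"
  shows "bihomogeneous i' j' (f ^ n)"
  unfolding assms(2,3)
proof (induction n)
  case 0
  show ?case using bihomogeneous_const[of 1] by simp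
next
  case (Suc n)
  show ?case unfolding power_Suc
    by (rule bihomogeneous_mult[OF assms(1) Suc.IH]) (simp_all add: algebra_simps)
qed

lemma value_at_scale:
  assumes "bihomogeneous i j f"
  shows "value_at (c * s, c * u) (d * t, d * v) f = c ^ nat i * d ^ nat j * value_at (s, u) (t, v) f"
  unfolding poly_subst_alt sum_distrib_left
proof (rule sum.cong[OF refl])
  fix e assume e: "e \<in> Poly_Mapping.keys f"
  have "nat i = Poly_Mapping.lookup e VS + Poly_Mapping.lookup e VU"
       "nat j = Poly_Mapping.lookup e VT + Poly_Mapping.lookup e VV"
    using assms e by (force simp: bihomogeneous_def)+
  then show "id (Poly_Mapping.lookup f e) * monomial_value (coords (c * s, c * u) (d * t, d * v)) e =
      c ^ nat i * d ^ nat j * (id (Poly_Mapping.lookup f e) * monomial_value (coords (s, u) (t, v)) e)"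
    by (simp add: monomial_value_expand power_mult_distrib power_add)
qed

section \<open>Homogenisation\<close>

abbreviation std_chart :: "'k::field bipoly \<Rightarrow> 'k poly poly" where
  "std_chart \<equiv> chart (1, 0) (1, 0)"

lemma std_chart_alt:
  "std_chart f = (\<Sum>e\<in>Poly_Mapping.keys f.
     monom (monom (Poly_Mapping.lookup f e) (Poly_Mapping.lookup e VU)) (Poly_Mapping.lookup e VV))"
  unfolding chart_def poly_subst_alt
  by (intro sum.cong refl)
     (simp add: monomial_value_expand chart_coords_def monom_altdef smult_monom
       flip: ring_map_power[OF ring_map_const_poly])

text \<open>
  In a bihomogeneous polynomial the exponents of \<open>s\<close> and \<open>t\<close> are determined by those of \<open>u\<close> and \<open>v\<close>, so
  setting \<open>s = t = 1\<close> does not merge monomials.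
\<close>

lemma std_chart_coeff_key:
  assumes f: "bihomogeneous i j f" and e: "e \<in> Poly_Mapping.keys f"
  shows "coeff (coeff (std_chart f) (Poly_Mapping.lookup e VV)) (Poly_Mapping.lookup e VU) =
    Poly_Mapping.lookup f e"
proof -
  have uniq: "e' = e" if "e' \<in> Poly_Mapping.keys f" "Poly_Mapping.lookup e' VU = Poly_Mapping.lookup e VU"
      "Poly_Mapping.lookup e' VV = Poly_Mapping.lookup e VV" for e'
  proof (rule poly_mapping_eqI)
    fix x
    have "Poly_Mapping.lookup e' VS = Poly_Mapping.lookup e VS"
         "Poly_Mapping.lookup e' VT = Poly_Mapping.lookup e VT"
      using f[unfolded bihomogeneous_def, rule_format, OF e]
        f[unfolded bihomogeneous_def, rule_format, OF that(1)] that(2,3) by linarith+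
    then show "Poly_Mapping.lookup e' x = Poly_Mapping.lookup e x" using that by (cases x) auto
  qed
  have "coeff (coeff (std_chart f) (Poly_Mapping.lookup e VV)) (Poly_Mapping.lookup e VU) =
      (\<Sum>e'\<in>Poly_Mapping.keys f. if e' = e then Poly_Mapping.lookup f e' else 0)"
    unfolding std_chart_alt coeff_sum
    using uniq by (intro sum.cong) (auto simp: coeff_monom)
  also have "\<dots> = Poly_Mapping.lookup f e" using e by simp
  finally show ?thesis .
qed

lemma std_chart_degree_bound:
  assumes f: "bihomogeneous i j f" and nz: "coeff (coeff (std_chart f) d) c \<noteq> 0"
  shows "int c \<le> i \<and> int d \<le> j"
proof -
  have "\<exists>e\<in>Poly_Mapping.keys f. Poly_Mapping.lookup e VU = c \<and> Poly_Mapping.lookup e VV = d"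
  proof (rule ccontr)
    assume none: "\<not> ?thesis"
    have "coeff (coeff (std_chart f) d) c = 0"
      unfolding std_chart_alt coeff_sum
      using none by (intro sum.neutral) auto
    then show False using nz by simp
  qed
  then show ?thesis using f by (force simp: bihomogeneous_def)
qed

lemma chart_point_covers:
  fixes p :: "'k::field \<times> 'k"
  assumes "x \<noteq> 0"
  shows "\<exists>c x'. c \<noteq> 0 \<and> (1, x) = (c * fst (chart_point p x'), c * snd (chart_point p x'))"
proof (cases "fst p = 0")
  case True
  then show ?thesis using assms
    by - (rule exI[of _ x], rule exI[of _ "1 / x"], simp add: chart_point_def)
next
  case False
  then show ?thesis
    by - (rule exI[of _ 1], rule exI[of _ "x - snd p / fst p"], simp add: chart_point_def)
qed

text \<open>
  Every point off the coordinate lines lies in the chart. If the dehomogenisation of \<open>f\<close> vanishes, then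
  so does \<open>f\<close> at all these points, hence also its dehomogenisation in the standard chart.
\<close>

lemma chart_eq_0D:
  fixes f :: "'k::alg_closed_field bipoly"
  assumes f: "bihomogeneous i j f" and "chart p q f = 0"
  shows "f = 0"
proof -
  have "eval2 x y (std_chart f) = 0" if xy: "x \<notin> {0}" "y \<notin> {0}" for x y
  proof -
    obtain c x' where c: "(1, x) = (c * fst (chart_point p x'), c * snd (chart_point p x'))"
      using chart_point_covers xy by blast
    obtain d y' where d: "(1, y) = (d * fst (chart_point q y'), d * snd (chart_point q y'))"
      using chart_point_covers xy by blast
    have "eval2 x y (std_chart f) = value_at (1, x) (1, y) f"
      by (simp add: eval2_chart chart_point_def)
    also have "\<dots> = c ^ nat i * d ^ nat j * value_at (chart_point p x') (chart_point q y') f"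
      unfolding c d value_at_scale[OF f] by simp
    also have "value_at (chart_point p x') (chart_point q y') f = 0"
      unfolding eval2_chart[symmetric] assms(2) by simp
    finally show ?thesis by simp
  qed
  then have std: "std_chart f = 0" by (intro bivariate_eq_0I[of "{0}"]) auto
  have "Poly_Mapping.keys f = {}"
    using std_chart_coeff_key[OF f] unfolding std by (metis coeff_0 equals0I in_keys_iff)
  then show ?thesis by simp
qed

lemma chart_eqD:
  fixes f g :: "'k::alg_closed_field bipoly"
  assumes "bihomogeneous i j f" "bihomogeneous i j g" "chart p q f = chart p q g"
  shows "f = g"
  using chart_eq_0D[OF bihomogeneous_diff[OF assms(1,2)], of p q] assms(3)
  by (simp add: ring_map_diff[OF ring_map_chart])

text \<open>
  The linear forms that the chart around \<open>p\<close> sends to \<open>1\<close> and to the local parameter; \<open>x0\<close> and \<open>x1\<close> are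
  the homogeneous coordinates \<open>s, u\<close> or \<open>t, v\<close> of the respective factor.
\<close>

definition chart_unit :: "var \<Rightarrow> var \<Rightarrow> 'k::field \<times> 'k \<Rightarrow> 'k bipoly" where
  "chart_unit x0 x1 p = (if fst p \<noteq> 0 then X_of x0 else X_of x1)"

definition chart_param :: "var \<Rightarrow> var \<Rightarrow> 'k::field \<times> 'k \<Rightarrow> 'k bipoly" where
  "chart_param x0 x1 p = (if fst p \<noteq> 0 then X_of x1 - const (snd p / fst p) * X_of x0 else X_of x0)"

lemma bihomogeneous_chart_lines:
  "bihomogeneous 1 0 (chart_unit VS VU p)" "bihomogeneous 0 1 (chart_unit VT VV p)"
  "bihomogeneous 1 0 (chart_param VS VU p)" "bihomogeneous 0 1 (chart_param VT VV p)"
  using bihomogeneous_X_of[of VS] bihomogeneous_X_of[of VU] bihomogeneous_X_of[of VT] bihomogeneous_X_of[of VV]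
  by (auto simp: chart_unit_def chart_param_def
      intro!: bihomogeneous_diff intro: bihomogeneous_mult[OF bihomogeneous_const])

lemma chart_const [simp]: "chart p q (const c) = [:[:c:]:]"
  by (simp add: chart_def poly_subst_single[OF ring_map_const_const] monomial_value_def)

lemma chart_chart_lines [simp]:
  "chart p q (chart_unit VS VU p) = 1" "chart p q (chart_unit VT VV q) = 1"
  "chart p q (chart_param VS VU p) = [:[:0, 1:]:]" "chart p q (chart_param VT VV q) = [:0, 1:]"
proof -
  have X: "chart p q (X_of x) = coords (chart_coords p [:[:0, 1:]:]) (chart_coords q [:0, 1:]) x" for x
    unfolding chart_def by (rule poly_subst_X_of[OF ring_map_const_const])
  show "chart p q (chart_unit VS VU p) = 1" "chart p q (chart_unit VT VV q) = 1"
    "chart p q (chart_param VS VU p) = [:[:0, 1:]:]" "chart p q (chart_param VT VV q) = [:0, 1:]"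
    by (cases "chart_coords p [:[:0, 1:]:]"; cases "chart_coords q [:0, 1:]";
        auto simp: chart_unit_def chart_param_def X ring_map_simps[OF ring_map_chart] chart_coords_def
          split: if_splits)+
qed

text \<open>
  The preimage is the homogenisation of \<open>g\<close> with respect to the two linear forms of each factor.
\<close>

lemma chart_surj:
  fixes g :: "'k::field poly poly"
  assumes bound: "\<And>c d. coeff (coeff g d) c \<noteq> 0 \<Longrightarrow> int c \<le> i \<and> int d \<le> j"
  shows "\<exists>f. bihomogeneous i j f \<and> chart p q f = g"
proof -
  define T where "T d c = const (coeff (coeff g d) c) *
      (chart_param VS VU p ^ c * chart_unit VS VU p ^ nat (i - int c) *
      (chart_param VT VV q ^ d * chart_unit VT VV q ^ nat (j - int d)))" for d c
  define f where "f = (\<Sum>d\<le>degree g. \<Sum>c\<le>degree (coeff g d). T d c)"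
  have "bihomogeneous i j (T d c)" for d c
  proof (cases "coeff (coeff g d) c = 0")
    case False
    then have ij: "int c \<le> i" "int d \<le> j" using bound by auto
    have 1: "bihomogeneous (int c) 0 (chart_param VS VU p ^ c)"
            "bihomogeneous (i - int c) 0 (chart_unit VS VU p ^ nat (i - int c))"
      by (rule bihomogeneous_power[OF bihomogeneous_chart_lines(3)]
          bihomogeneous_power[OF bihomogeneous_chart_lines(1)]; use ij in simp)+
    have 2: "bihomogeneous 0 (int d) (chart_param VT VV q ^ d)"
            "bihomogeneous 0 (j - int d) (chart_unit VT VV q ^ nat (j - int d))"
      by (rule bihomogeneous_power[OF bihomogeneous_chart_lines(4)]
          bihomogeneous_power[OF bihomogeneous_chart_lines(2)]; use ij in simp)+
    show ?thesis unfolding T_def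
      by (rule bihomogeneous_mult[OF bihomogeneous_const bihomogeneous_mult[OF
            bihomogeneous_mult[OF 1 refl refl] bihomogeneous_mult[OF 2 refl refl] refl refl]])
         (use ij in simp_all)
  qed (simp add: T_def)
  then have f: "bihomogeneous i j f" unfolding f_def by (intro bihomogeneous_sum)
  have "chart p q (T d c) = monom (monom (coeff (coeff g d) c) c) d" for d c
    unfolding T_def ring_map_simps[OF ring_map_chart]
    by (simp add: monom_altdef smult_monom flip: ring_map_power[OF ring_map_const_poly])
  then have "chart p q f = (\<Sum>d\<le>degree g. \<Sum>c\<le>degree (coeff g d). monom (monom (coeff (coeff g d) c) c) d)"
    unfolding f_def ring_map_simps[OF ring_map_chart] by simp
  also have "\<dots> = (\<Sum>d\<le>degree g. monom (coeff g d) d)"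
    by (simp flip: monom_sum add: poly_as_sum_of_monoms)
  also have "\<dots> = g" by (rule poly_as_sum_of_monoms)
  finally show ?thesis using f by blast
qed

lemma chart_surj_eventually:
  fixes g :: "'k::field poly poly"
  shows "\<exists>N. \<forall>i\<ge>N. \<forall>j\<ge>N. \<exists>f. bihomogeneous i j f \<and> chart p q f = g"
proof (rule exI[of _ "int (degree g + degree (swap g))"], intro allI impI)
  fix i j assume ij: "i \<ge> int (degree g + degree (swap g))" "j \<ge> int (degree g + degree (swap g))"
  have "int c \<le> i \<and> int d \<le> j" if nz: "coeff (coeff g d) c \<noteq> 0" for c d
  proof -
    have "d \<le> degree g" using nz by (intro le_degree) auto
    moreover have "c \<le> degree (swap g)" using nz by (intro le_degree) (metis coeff_swap coeff_0)
    ultimately show ?thesis using ij by simp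
  qed
  then show "\<exists>f. bihomogeneous i j f \<and> chart p q f = g" by (rule chart_surj)
qed

section \<open>Base points and syzygies on affine charts\<close>

lemma proj_class: "p \<noteq> (0, 0) \<Longrightarrow> proj_rel `` {p} = {(c * fst p, c * snd p) | c. c \<noteq> 0}"
  by (cases p) (auto simp: proj_rel_def)

lemma proj_class_self: "p \<noteq> (0, 0) \<Longrightarrow> p \<in> proj_rel `` {p}"
  by (subst proj_class) (auto intro!: exI[of _ 1] simp: prod_eq_iff)

lemma in_zero_setI:
  assumes "p \<noteq> (0, 0)" "q \<noteq> (0, 0)"
    and "\<And>f. f \<in> F \<Longrightarrow> bihomogeneous m n f \<and> value_at p q f = 0"
  shows "(proj_rel `` {p}, proj_rel `` {q}) \<in> zero_set F"
proof -
  have "proj_rel `` {p} \<in> proj_line" "proj_rel `` {q} \<in> proj_line"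
    using assms(1,2) by (auto simp: proj_line_def intro: quotientI)
  moreover have "value_at p' q' f = 0" if f: "f \<in> F" and pq: "p' \<in> proj_rel `` {p}" "q' \<in> proj_rel `` {q}" for f p' q'
  proof -
    obtain c d where "p' = (c * fst p, c * snd p)" "q' = (d * fst q, d * snd q)"
      using pq proj_class[OF assms(1)] proj_class[OF assms(2)] by blast
    then show ?thesis using assms(3)[OF f] by (auto simp: value_at_scale)
  qed
  ultimately show ?thesis by (simp add: zero_set_def)
qed

lemma chart_point_nonzero: "chart_point p x \<noteq> (0, 0)"
  by (simp add: chart_point_def)

lemma chart_point_class_inj:
  assumes "proj_rel `` {chart_point p x} = proj_rel `` {chart_point p x'}"
  shows "x = x'"
proof -
  have "chart_point p x \<in> proj_rel `` {chart_point p x'}"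
    using proj_class_self[OF chart_point_nonzero] assms by metis
  then show ?thesis
    unfolding proj_class[OF chart_point_nonzero] by (auto simp: chart_point_def split: if_splits)
qed

lemma finite_chart_zeros:
  assumes "bihomogeneous m n a" "bihomogeneous m n b" "bihomogeneous m n c"
    and "finite (zero_set {a, b, c})"
  shows "finite {(x, y). eval2 x y (chart p q a) = 0 \<and> eval2 x y (chart p q b) = 0 \<and> eval2 x y (chart p q c) = 0}"
    (is "finite ?Z")
proof (rule inj_on_finite[OF _ _ assms(4)])
  let ?F = "\<lambda>(x, y). (proj_rel `` {chart_point p x}, proj_rel `` {chart_point q y})"
  show "inj_on ?F ?Z"
    by (rule inj_onI) (auto dest!: chart_point_class_inj)
  show "?F ` ?Z \<subseteq> zero_set {a, b, c}"
    using assms(1-3)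
    by (auto intro!: in_zero_setI[of _ _ _ m n] chart_point_nonzero simp: eval2_chart)
qed

lemma power_in_ideal_power: "x \<in> I \<Longrightarrow> x ^ j \<in> ideal_power I j"
  by (induction j) (auto intro!: ideal_gen_base)

text \<open>
  Some power of the product of the two forms \<open>chart_unit\<close> multiplies \<open>f\<close> into the ideal, and the chart
  sends this product to \<open>1\<close>.
\<close>

lemma chart_saturation:
  assumes "f \<in> saturation (ideal_gen {a, b, c})"
  shows "chart p q f \<in> ideal_gen {chart p q a, chart p q b, chart p q c}"
proof -
  define w where "w = chart_unit VS VU p * chart_unit VT VV q"
  have "w \<in> irrelevant_ideal"
    unfolding irrelevant_ideal_def w_def chart_unit_def by (intro ideal_gen_base) auto
  then obtain j where "w ^ j * f \<in> ideal_gen {a, b, c}"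
    using assms power_in_ideal_power by (force simp: saturation_def)
  from ring_map_ideal_gen_three[OF ring_map_chart[of p q] this] show ?thesis
    by (simp add: ring_map_simps[OF ring_map_chart] w_def)
qed

lemma ideal_gen_image:
  assumes h: "ring_map h"
  shows "ideal_gen (h ` ideal_gen {a, b, c}) = ideal_gen {h a, h b, h c}"
proof
  show "ideal_gen {h a, h b, h c} \<subseteq> ideal_gen (h ` ideal_gen {a, b, c})"
    unfolding ideal_gen_def[of "{h a, h b, h c}"] ideal_gen_def[of "h ` _"]
    by (rule module.span_mono[OF module_times]) (auto intro!: imageI ideal_gen_base)
  show "ideal_gen (h ` ideal_gen {a, b, c}) \<subseteq> ideal_gen {h a, h b, h c}"
    unfolding ideal_gen_def[of "h ` _"]
  proof (rule module.span_minimal[OF module_times])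
    show "h ` ideal_gen {a, b, c} \<subseteq> ideal_gen {h a, h b, h c}"
      using ring_map_ideal_gen_three[OF h] by blast
    show "module.subspace (*) (ideal_gen {h a, h b, h c})"
      unfolding ideal_gen_def by (rule module.subspace_span[OF module_times])
  qed
qed

definition koszul_via ::
  "int \<Rightarrow> int \<Rightarrow> 'k::comm_ring_1 bipoly \<Rightarrow> 'k bipoly \<Rightarrow> 'k bipoly \<Rightarrow> 'k bipoly \<Rightarrow> 'k bipoly \<Rightarrow> 'k bipoly \<Rightarrow>
    'k bipoly \<Rightarrow> 'k bipoly \<Rightarrow> 'k bipoly \<Rightarrow> bool" where
  "koszul_via i j a b c A B C h1 h2 h3 \<longleftrightarrow>
     bihomogeneous i j h1 \<and> bihomogeneous i j h2 \<and> bihomogeneous i j h3 \<and>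
     A = h1 * c + h2 * b \<and> B = - h2 * a + h3 * c \<and> C = - h1 * a - h3 * b"

text \<open>
  The coefficients of a Koszul syzygy in the chart can be homogenised as soon as the bidegree is large
  enough to accommodate them.
\<close>

lemma koszul_from_chart:
  fixes a b c A B C :: "'k::alg_closed_field bipoly"
  assumes a: "bihomogeneous m n a" and b: "bihomogeneous m n b" and c: "bihomogeneous m n c"
    and A: "bihomogeneous k l A" and B: "bihomogeneous k l B" and C: "bihomogeneous k l C"
    and kos: "koszul (chart p q a) (chart p q b) (chart p q c)
      (H * chart p q A) (H * chart p q B) (H * chart p q C)"
  shows "\<exists>N. \<forall>i j G. i \<ge> N \<longrightarrow> j \<ge> N \<longrightarrow> bihomogeneous i j G \<longrightarrow> chart p q G = H \<longrightarrow>
    (\<exists>h1 h2 h3. koszul_via (i + k - m) (j + l - n) a b c (G * A) (G * B) (G * C) h1 h2 h3)"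
proof -
  obtain g1 g2 g3 where g: "H * chart p q A = g1 * chart p q c + g2 * chart p q b"
      "H * chart p q B = - g2 * chart p q a + g3 * chart p q c"
      "H * chart p q C = - g1 * chart p q a - g3 * chart p q b"
    using kos by (rule koszulE)
  obtain N1 where N1: "\<And>i j. i \<ge> N1 \<Longrightarrow> j \<ge> N1 \<Longrightarrow> \<exists>f. bihomogeneous i j f \<and> chart p q f = g1"
    using chart_surj_eventually by blast
  obtain N2 where N2: "\<And>i j. i \<ge> N2 \<Longrightarrow> j \<ge> N2 \<Longrightarrow> \<exists>f. bihomogeneous i j f \<and> chart p q f = g2"
    using chart_surj_eventually by blast
  obtain N3 where N3: "\<And>i j. i \<ge> N3 \<Longrightarrow> j \<ge> N3 \<Longrightarrow> \<exists>f. bihomogeneous i j f \<and> chart p q f = g3"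
    using chart_surj_eventually by blast
  show ?thesis
  \<comment> \<open>This bound makes \<open>i + k - m\<close> and \<open>j + l - n\<close> at least as large as \<open>N1\<close>, \<open>N2\<close> and \<open>N3\<close>.\<close>
  proof (rule exI[of _ "\<bar>N1\<bar> + \<bar>N2\<bar> + \<bar>N3\<bar> + \<bar>m\<bar> + \<bar>n\<bar> + \<bar>k\<bar> + \<bar>l\<bar>"], intro allI impI, goal_cases)
    case (1 i j G)
    define i' where "i' = i + k - m"
    define j' where "j' = j + l - n"
    have "m - k \<le> \<bar>m\<bar> + \<bar>k\<bar>" "n - l \<le> \<bar>n\<bar> + \<bar>l\<bar>"
      "N1 \<le> \<bar>N1\<bar>" "N2 \<le> \<bar>N2\<bar>" "N3 \<le> \<bar>N3\<bar>" by linarith+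
    then have ij: "i' \<ge> N1" "i' \<ge> N2" "i' \<ge> N3" "j' \<ge> N1" "j' \<ge> N2" "j' \<ge> N3"
      using 1(1,2) abs_ge_zero[of N1] abs_ge_zero[of N2] abs_ge_zero[of N3] abs_ge_zero[of m]
        abs_ge_zero[of n] abs_ge_zero[of k] abs_ge_zero[of l]
      unfolding i'_def j'_def by linarith+
    obtain h1 where h1: "bihomogeneous i' j' h1" "chart p q h1 = g1" using N1 ij by blast
    obtain h2 where h2: "bihomogeneous i' j' h2" "chart p q h2 = g2" using N2 ij by blast
    obtain h3 where h3: "bihomogeneous i' j' h3" "chart p q h3 = g3" using N3 ij by blast
    have left: "bihomogeneous (i + k) (j + l) (G * F)" if "bihomogeneous k l F" for F
      by (rule bihomogeneous_mult[OF 1(3) that refl refl])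
    have right: "bihomogeneous (i + k) (j + l) (h * f)"
      if "bihomogeneous i' j' h" "bihomogeneous m n f" for h f
      by (rule bihomogeneous_mult[OF that]) (simp_all add: i'_def j'_def)
    note simps = ring_map_simps[OF ring_map_chart] 1(4) h1(2) h2(2) h3(2)
    have "G * A = h1 * c + h2 * b"
      by (rule chart_eqD[where p = p and q = q, OF left[OF A] bihomogeneous_add[OF right[OF h1(1) c] right[OF h2(1) b]]])
         (simp only: simps g)
    moreover have "G * B = - h2 * a + h3 * c"
      by (rule chart_eqD[where p = p and q = q, OF left[OF B]
          bihomogeneous_add[OF right[OF bihomogeneous_uminus[OF h2(1)] a] right[OF h3(1) c]]])
         (simp only: simps g)
    moreover have "G * C = - h1 * a - h3 * b"
      by (rule chart_eqD[where p = p and q = q, OF left[OF C]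
          bihomogeneous_diff[OF right[OF bihomogeneous_uminus[OF h1(1)] a] right[OF h3(1) b]]])
         (simp only: simps g)
    ultimately show ?case using h1(1) h2(1) h3(1) unfolding i'_def j'_def koszul_via_def by blast
  qed
qed

text \<open>
  The conductor of \<open>(A, B, C)\<close> into the Koszul syzygies contains an element that does not vanish at
  \<open>(p, q)\<close>. Off the base points this is one of \<open>a\<close>, \<open>b\<close>, \<open>c\<close>. At a base point the two generators of the
  completed ideal yield a polynomial syzygy of \<open>a\<close>, \<open>b\<close>, \<open>c\<close> with an entry \<open>H\<close> that does not vanish at the
  point, and \<open>H^2\<close> lies in the conductor by \<open>koszul_of_syzygy\<close>.
\<close>

lemma koszul_at_point:
  fixes a b c A B C :: "'k::alg_closed_field bipoly"
  assumes a: "bihomogeneous m n a" and b: "bihomogeneous m n b" and c: "bihomogeneous m n c"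
    and fin: "finite (zero_set {a, b, c})"
    and curv: "\<And>z. z \<in> zero_set {a, b, c} \<Longrightarrow> curvilinear_at (ideal_gen {a, b, c}) z"
    and A: "bihomogeneous k l A" and B: "bihomogeneous k l B" and C: "bihomogeneous k l C"
    and syz: "A * a + B * b + C * c = 0"
    and sat: "{A, B, C} \<subseteq> saturation (ideal_gen {a, b, c})"
    and p: "p \<noteq> (0, 0)" and q: "q \<noteq> (0, 0)"
  shows "\<exists>G. value_at p q G \<noteq> 0 \<and> koszul a b c (G * A) (G * B) (G * C)"
proof (cases "value_at p q a = 0 \<and> value_at p q b = 0 \<and> value_at p q c = 0")
  case False
  then obtain f where "f \<in> {a, b, c}" "value_at p q f \<noteq> 0" by blast
  then show ?thesis using koszul_mult_ideal[OF syz ideal_gen_base] by blast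
next
  case True
  have "(proj_rel `` {p}, proj_rel `` {q}) \<in> zero_set {a, b, c}"
    by (rule in_zero_setI[OF p q, of _ m n]) (use True a b c in auto)
  from curv[OF this] obtain x y :: "'k fps fps" and r :: nat
    where "local_ideal (ideal_gen {a, b, c}) p q = ideal_gen {x, y ^ r}"
    using proj_class_self[OF p] proj_class_self[OF q] unfolding curvilinear_at_def fst_conv snd_conv
    by blast
  then have two: "ideal_gen {germ p q a, germ p q b, germ p q c} = ideal_gen {x, y ^ r}"
    by (simp add: local_ideal_def ideal_gen_image[OF ring_map_germ])
  define a' where "a' = chart p q a"
  define b' where "b' = chart p q b"
  define c' where "c' = chart p q c"
  obtain P where P: "P \<noteq> 0" "[:P:] \<in> ideal_gen {a', b', c'}"
    using elimination_x[OF finite_chart_zeros[OF a b c fin]] unfolding a'_def b'_def c'_def by blast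
  obtain Q where Q: "Q \<noteq> 0" "const_y Q \<in> ideal_gen {a', b', c'}"
    using elimination_y[OF finite_chart_zeros[OF a b c fin]] unfolding a'_def b'_def c'_def by blast
  obtain l1 l2 l3 F1 F2 F3 where rel: "l1 \<noteq> 0 \<or> l2 \<noteq> 0 \<or> l3 \<noteq> 0"
    "fps_nth (fps_nth F1 0) 0 = 0" "fps_nth (fps_nth F2 0) 0 = 0" "fps_nth (fps_nth F3 0) 0 = 0"
    "ser_const l1 * to_series a' + ser_const l2 * to_series b' + ser_const l3 * to_series c' =
      F1 * to_series a' + F2 * to_series b' + F3 * to_series c'"
    using relation_of_two_generators[OF two] unfolding a'_def b'_def c'_def to_series_chart by blast
  obtain G1 G2 G3 where G: "G1 * a' + G2 * b' + G3 * c' = 0"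
    "eval2 0 0 G1 \<noteq> 0 \<or> eval2 0 0 G2 \<noteq> 0 \<or> eval2 0 0 G3 \<noteq> 0"
    using syzygy_of_relation[OF P Q rel] by blast
  obtain H where H: "H \<in> {G1, G2, G3}" "eval2 0 0 H \<noteq> 0" using G(2) by blast
  have syz': "chart p q A * a' + chart p q B * b' + chart p q C * c' = 0"
    unfolding a'_def b'_def c'_def using syz
    by (simp flip: ring_map_simps[OF ring_map_chart] add: ring_map_zero[OF ring_map_chart])
  have "{chart p q A, chart p q B, chart p q C} \<subseteq> ideal_gen {a', b', c'}"
    unfolding a'_def b'_def c'_def using sat chart_saturation by blast
  from koszul_of_syzygy[OF P Q syz' this G(1) H(1)]
  have "koszul (chart p q a) (chart p q b) (chart p q c)
      (H^2 * chart p q A) (H^2 * chart p q B) (H^2 * chart p q C)"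
    by (simp only: a'_def b'_def c'_def)
  from koszul_from_chart[OF a b c A B C this] obtain N1
    where N1: "\<And>i j G. i \<ge> N1 \<Longrightarrow> j \<ge> N1 \<Longrightarrow> bihomogeneous i j G \<Longrightarrow> chart p q G = H^2 \<Longrightarrow>
      koszul a b c (G * A) (G * B) (G * C)"
    unfolding koszul_via_def koszul_def by blast
  obtain N2 where N2: "\<And>i j. i \<ge> N2 \<Longrightarrow> j \<ge> N2 \<Longrightarrow> \<exists>G. bihomogeneous i j G \<and> chart p q G = H^2"
    using chart_surj_eventually by blast
  define N where "N = max N1 N2"
  obtain G where G: "bihomogeneous N N G" "chart p q G = H^2" using N2[of N N] by (auto simp: N_def)
  have kos: "koszul a b c (G * A) (G * B) (G * C)" using N1[OF _ _ G] by (simp add: N_def)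
  have "value_at (chart_point p 0) (chart_point q 0) G = eval2 0 0 (H^2)"
    by (simp flip: eval2_chart add: G(2))
  then have nz: "value_at (chart_point p 0) (chart_point q 0) G \<noteq> 0" using H(2) by simp
  have rep: "\<exists>c. c \<noteq> 0 \<and> p = (c * fst (chart_point p 0), c * snd (chart_point p 0))"
    if "p \<noteq> (0, 0)" for p :: "'k \<times> 'k"
    using that
    by (intro exI[of _ "if fst p \<noteq> 0 then fst p else snd p"]) (auto simp: chart_point_def prod_eq_iff)
  obtain s where s: "s \<noteq> 0" "p = (s * fst (chart_point p 0), s * snd (chart_point p 0))"
    using rep[OF p] by blast
  obtain t where t: "t \<noteq> 0" "q = (t * fst (chart_point q 0), t * snd (chart_point q 0))"
    using rep[OF q] by blast
  have "value_at p q G = s ^ nat N * t ^ nat N * value_at (chart_point p 0) (chart_point q 0) G"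
    by (subst s(2), subst t(2), subst value_at_scale[OF G(1)]) simp
  then have "value_at p q G \<noteq> 0" using nz s(1) t(1) by simp
  then show ?thesis using kos by blast
qed

text \<open>
  The conductor \<open>J\<close> contains the ideal, hence a polynomial in each of the variables, and it has no zeros
  in the chart, so it is the unit ideal.
\<close>

lemma koszul_on_chart:
  fixes a b c A B C :: "'k::alg_closed_field bipoly"
  assumes a: "bihomogeneous m n a" and b: "bihomogeneous m n b" and c: "bihomogeneous m n c"
    and fin: "finite (zero_set {a, b, c})"
    and curv: "\<And>z. z \<in> zero_set {a, b, c} \<Longrightarrow> curvilinear_at (ideal_gen {a, b, c}) z"
    and A: "bihomogeneous k l A" and B: "bihomogeneous k l B" and C: "bihomogeneous k l C"
    and syz: "A * a + B * b + C * c = 0"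
    and sat: "{A, B, C} \<subseteq> saturation (ideal_gen {a, b, c})"
  shows "koszul (chart p q a) (chart p q b) (chart p q c) (chart p q A) (chart p q B) (chart p q C)"
proof -
  define a' where "a' = chart p q a"
  define b' where "b' = chart p q b"
  define c' where "c' = chart p q c"
  define J where "J = {f. koszul a' b' c' (f * chart p q A) (f * chart p q B) (f * chart p q C)}"
  have syz': "chart p q A * a' + chart p q B * b' + chart p q C * c' = 0"
    unfolding a'_def b'_def c'_def using syz
    by (simp flip: ring_map_simps[OF ring_map_chart] add: ring_map_zero[OF ring_map_chart])
  have I: "f \<in> J" if "f \<in> ideal_gen {a', b', c'}" for f
    unfolding J_def using koszul_mult_ideal[OF syz' that] by simp
  obtain P where P: "P \<noteq> 0" "[:P:] \<in> ideal_gen {a', b', c'}"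
    using elimination_x[OF finite_chart_zeros[OF a b c fin]] unfolding a'_def b'_def c'_def by blast
  obtain Q where Q: "Q \<noteq> 0" "const_y Q \<in> ideal_gen {a', b', c'}"
    using elimination_y[OF finite_chart_zeros[OF a b c fin]] unfolding a'_def b'_def c'_def by blast
  have "1 \<in> J"
  proof (rule one_in_ideal_bivariate[OF _ _ P(1) I[OF P(2)] Q(1) I[OF Q(2)]])
    show "f + g \<in> J" if "f \<in> J" "g \<in> J" for f g
      using that koszul_add unfolding J_def by (simp add: distrib_right) blast
    show "r * f \<in> J" if "f \<in> J" for r f
      using that koszul_mult unfolding J_def by (simp add: mult.assoc) blast
    show "\<exists>g\<in>J. eval2 x y g \<noteq> 0" for x y
    proof -
      obtain G where G: "value_at (chart_point p x) (chart_point q y) G \<noteq> 0"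
          "koszul a b c (G * A) (G * B) (G * C)"
        using koszul_at_point[OF a b c fin curv A B C syz sat chart_point_nonzero chart_point_nonzero]
        by blast
      have "chart p q G \<in> J"
        using koszul_ring_map[OF ring_map_chart[of p q] G(2)]
        by (simp add: J_def a'_def b'_def c'_def ring_map_mult[OF ring_map_chart])
      then show ?thesis using G(1) by (auto simp flip: eval2_chart)
    qed
  qed
  then show ?thesis by (simp add: J_def a'_def b'_def c'_def)
qed

text \<open>
  For \<open>p, q\<close> among \<open>(1, 0)\<close> and \<open>(0, 1)\<close> the forms \<open>chart_unit\<close> are the variables, and the chart is the
  locus where two of them are invertible.
\<close>

lemma koszul_up_to_power:
  fixes a b c A B C :: "'k::alg_closed_field bipoly"
  assumes a: "bihomogeneous m n a" and b: "bihomogeneous m n b" and c: "bihomogeneous m n c"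
    and A: "bihomogeneous k l A" and B: "bihomogeneous k l B" and C: "bihomogeneous k l C"
    and kos: "koszul (chart p q a) (chart p q b) (chart p q c) (chart p q A) (chart p q B) (chart p q C)"
  shows "\<exists>N0. \<forall>N\<ge>N0. \<exists>h1 h2 h3. koszul_via (int N + k - m) (int N + l - n) a b c
      (chart_unit VS VU p ^ N * chart_unit VT VV q ^ N * A)
      (chart_unit VS VU p ^ N * chart_unit VT VV q ^ N * B)
      (chart_unit VS VU p ^ N * chart_unit VT VV q ^ N * C) h1 h2 h3"
proof -
  have kos1: "koszul (chart p q a) (chart p q b) (chart p q c)
      (1 * chart p q A) (1 * chart p q B) (1 * chart p q C)" using kos by simp
  obtain N0 where N0: "\<And>i j G. i \<ge> N0 \<Longrightarrow> j \<ge> N0 \<Longrightarrow> bihomogeneous i j G \<Longrightarrow> chart p q G = 1 \<Longrightarrow>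
      \<exists>h1 h2 h3. koszul_via (i + k - m) (j + l - n) a b c (G * A) (G * B) (G * C) h1 h2 h3"
    using koszul_from_chart[OF a b c A B C kos1] by blast
  show ?thesis
  proof (rule exI[of _ "nat N0"], intro allI impI, rule N0)
    fix N assume "N \<ge> nat N0"
    then show "int N \<ge> N0" "int N \<ge> N0" by auto
    show "bihomogeneous (int N) (int N) (chart_unit VS VU p ^ N * chart_unit VT VV q ^ N)"
      by (rule bihomogeneous_mult[OF bihomogeneous_power[OF bihomogeneous_chart_lines(1) refl refl]
            bihomogeneous_power[OF bihomogeneous_chart_lines(2) refl refl]]) auto
    show "chart p q (chart_unit VS VU p ^ N * chart_unit VT VV q ^ N) = 1"
      by (simp add: ring_map_simps[OF ring_map_chart])
  qed
qed

text \<open>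
  A line on which \<open>a\<close>, \<open>b\<close>, \<open>c\<close> all vanish would consist of infinitely many base points.
\<close>

lemma not_all_vanish_on_line:
  assumes "bihomogeneous m n a" "bihomogeneous m n b" "bihomogeneous m n c"
    and "finite (zero_set {a, b, c})"
  shows "\<exists>f\<in>{a, b, c}. \<exists>x. value_at (1, x :: 'k::alg_closed_field) (0, 1) f \<noteq> 0"
    and "\<exists>f\<in>{a, b, c}. \<exists>y. value_at (0, 1) (1, y :: 'k) f \<noteq> 0"
proof -
  show "\<exists>f\<in>{a, b, c}. \<exists>x. value_at (1, x) (0, 1) f \<noteq> 0"
  proof (rule ccontr)
    assume "\<not> ?thesis"
    then have "range (\<lambda>x. (x, 0)) \<subseteq>
        {(x, y). eval2 x y (chart (1, 0) (0, 1) a) = 0 \<and> eval2 x y (chart (1, 0) (0, 1) b) = 0 \<and>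
          eval2 x y (chart (1, 0) (0, 1) c) = 0}"
      by (auto simp: eval2_chart chart_point_def)
    from finite_subset[OF this finite_chart_zeros[OF assms]]
    have "finite (UNIV :: 'k set)" by (rule finite_imageD) (auto intro: injI)
    then show False using infinite_UNIV_alg_closed by blast
  qed
  show "\<exists>f\<in>{a, b, c}. \<exists>y. value_at (0, 1) (1, y) f \<noteq> 0"
  proof (rule ccontr)
    assume "\<not> ?thesis"
    then have "range (\<lambda>y. (0, y)) \<subseteq>
        {(x, y). eval2 x y (chart (0, 1) (1, 0) a) = 0 \<and> eval2 x y (chart (0, 1) (1, 0) b) = 0 \<and>
          eval2 x y (chart (0, 1) (1, 0) c) = 0}"
      by (auto simp: eval2_chart chart_point_def)
    from finite_subset[OF this finite_chart_zeros[OF assms]]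
    have "finite (UNIV :: 'k set)" by (rule finite_imageD) (auto intro: injI)
    then show False using infinite_UNIV_alg_closed by blast
  qed
qed

text \<open>
  A form that does not vanish identically on the line \<open>t = 0\<close> has a monomial free of \<open>t\<close>, so its
  dehomogenisation attains the full degree in \<open>y\<close>; similarly for \<open>s\<close> and \<open>x\<close>.
\<close>

lemma std_chart_full_degree:
  fixes f :: "'k::field bipoly"
  assumes f: "bihomogeneous m n f"
  shows "value_at (1, x) (0, 1) f \<noteq> 0 \<Longrightarrow> n \<le> int (degree (std_chart f)) \<and> f \<noteq> 0"
    and "value_at (0, 1) (1, y) f \<noteq> 0 \<Longrightarrow> m \<le> int (degree (swap (std_chart f))) \<and> f \<noteq> 0"
proof -
  assume nz: "value_at (1, x) (0, 1) f \<noteq> 0"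
  then obtain e where e: "e \<in> Poly_Mapping.keys f" "Poly_Mapping.lookup e VT = 0"
    unfolding poly_subst_alt by (auto simp: monomial_value_expand elim!: sum.not_neutral_contains_not_neutral split: if_splits)
  have "coeff (std_chart f) (Poly_Mapping.lookup e VV) \<noteq> 0"
    using std_chart_coeff_key[OF f e(1)] e(1) by (metis coeff_0 in_keys_iff)
  then have "Poly_Mapping.lookup e VV \<le> degree (std_chart f)" by (rule le_degree)
  then show "n \<le> int (degree (std_chart f)) \<and> f \<noteq> 0"
    using f e unfolding bihomogeneous_def by force
next
  assume nz: "value_at (0, 1) (1, y) f \<noteq> 0"
  then obtain e where e: "e \<in> Poly_Mapping.keys f" "Poly_Mapping.lookup e VS = 0"
    unfolding poly_subst_alt by (auto simp: monomial_value_expand elim!: sum.not_neutral_contains_not_neutral split: if_splits)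
  have "coeff (swap (std_chart f)) (Poly_Mapping.lookup e VU) \<noteq> 0"
    using std_chart_coeff_key[OF f e(1)] e(1) by (metis coeff_0 in_keys_iff coeff_swap)
  then have "Poly_Mapping.lookup e VU \<le> degree (swap (std_chart f))" by (rule le_degree)
  then show "m \<le> int (degree (swap (std_chart f))) \<and> f \<noteq> 0"
    using f e unfolding bihomogeneous_def by force
qed

text \<open>
  The kernel of the Koszul map, in given bidegree. In the standard chart the factor \<open>e\<close> exists by
  \<open>proportional_up_to_factor\<close>. It can be homogenised to the right bidegree because in each of the two
  variables one of \<open>a\<close>, \<open>b\<close>, \<open>c\<close> has full degree, so that the degree of \<open>e\<close> is bounded by the difference of
  the degrees.
\<close>

lemma proportional_bihomogeneous:
  fixes a b c v1 v2 v3 :: "'k::alg_closed_field bipoly"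
  assumes a: "bihomogeneous m n a" and b: "bihomogeneous m n b" and c: "bihomogeneous m n c"
    and fin: "finite (zero_set {a, b, c})"
    and v1: "bihomogeneous i j v1" and v2: "bihomogeneous i j v2" and v3: "bihomogeneous i j v3"
    and ratio: "v1 * b = v2 * a" "v1 * c = v3 * a" "v2 * c = v3 * b"
  shows "\<exists>e. bihomogeneous (i - m) (j - n) e \<and> v1 = e * a \<and> v2 = e * b \<and> v3 = e * c"
proof -
  let ?d = "std_chart"
  obtain P where P: "P \<noteq> 0" "[:P:] \<in> ideal_gen {?d a, ?d b, ?d c}"
    using elimination_x[OF finite_chart_zeros[OF a b c fin]] by blast
  obtain Q where Q: "Q \<noteq> 0" "const_y Q \<in> ideal_gen {?d a, ?d b, ?d c}"
    using elimination_y[OF finite_chart_zeros[OF a b c fin]] by blast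
  have "\<exists>e. 1 * ?d v1 = e * ?d a \<and> 1 * ?d v2 = e * ?d b \<and> 1 * ?d v3 = e * ?d c"
    by (rule proportional_up_to_factor[OF P(1) _ Q(1)])
       (use P Q ratio in \<open>simp_all flip: ring_map_mult[OF ring_map_chart]\<close>)
  then obtain e where e: "?d v1 = e * ?d a" "?d v2 = e * ?d b" "?d v3 = e * ?d c" by auto
  have bound: "int x \<le> i - m \<and> int y \<le> j - n" if nz: "coeff (coeff e y) x \<noteq> 0" for x y
  proof
    have e0: "e \<noteq> 0" "swap e \<noteq> 0" using nz by (auto, metis coeff_swap coeff_0)
    obtain f x0 where f: "f \<in> {a, b, c}" "value_at (1, x0) (0, 1) f \<noteq> 0"
      using not_all_vanish_on_line(1)[OF a b c fin] by blast
    have fb: "bihomogeneous m n f" using f a b c by auto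
    obtain v where v: "bihomogeneous i j v" "?d v = e * ?d f" using f(1) e v1 v2 v3 by blast
    have df: "n \<le> int (degree (?d f))" "f \<noteq> 0" using std_chart_full_degree(1)[OF fb f(2)] by auto
    have "?d f \<noteq> 0" using df(2) chart_eq_0D[OF fb] by blast
    then have "degree e + degree (?d f) = degree (?d v)" using e0 by (simp add: v(2) degree_mult_eq)
    moreover have "int (degree (?d v)) \<le> j"
    proof -
      have "?d v \<noteq> 0" using \<open>?d f \<noteq> 0\<close> e0 v(2) by simp
      then have "coeff (?d v) (degree (?d v)) \<noteq> 0" by simp
      then obtain x' where "coeff (coeff (?d v) (degree (?d v))) x' \<noteq> 0"
        using leading_coeff_neq_0 by blast
      from std_chart_degree_bound[OF v(1) this] show ?thesis by simp
    qed
    moreover have "y \<le> degree e" using nz by (intro le_degree) auto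
    ultimately show "int y \<le> j - n" using df(1) by linarith
    obtain f y0 where f: "f \<in> {a, b, c}" "value_at (0, 1) (1, y0) f \<noteq> 0"
      using not_all_vanish_on_line(2)[OF a b c fin] by blast
    have fb: "bihomogeneous m n f" using f a b c by auto
    obtain v where v: "bihomogeneous i j v" "?d v = e * ?d f" using f(1) e v1 v2 v3 by blast
    have df: "m \<le> int (degree (swap (?d f)))" "f \<noteq> 0" using std_chart_full_degree(2)[OF fb f(2)] by auto
    have "?d f \<noteq> 0" using df(2) chart_eq_0D[OF fb] by blast
    then have sf: "swap (?d f) \<noteq> 0" by (metis swap_swap ring_map_zero ring_map_swap)
    then have "degree (swap e) + degree (swap (?d f)) = degree (swap (?d v))"
      using e0 by (simp add: v(2) degree_mult_eq ring_map_mult[OF ring_map_swap])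
    moreover have "int (degree (swap (?d v))) \<le> i"
    proof -
      have "swap (?d v) \<noteq> 0" using sf e0 v(2) by (simp add: ring_map_mult[OF ring_map_swap])
      then have "coeff (swap (?d v)) (degree (swap (?d v))) \<noteq> 0" by simp
      then obtain y' where "coeff (coeff (swap (?d v)) (degree (swap (?d v)))) y' \<noteq> 0"
        using leading_coeff_neq_0 by blast
      from this[unfolded coeff_swap] std_chart_degree_bound[OF v(1)] show ?thesis by blast
    qed
    moreover have "x \<le> degree (swap e)" using nz by (intro le_degree) (metis coeff_swap coeff_0)
    ultimately show "int x \<le> i - m" using df(1) by linarith
  qed
  obtain E where E: "bihomogeneous (i - m) (j - n) E" "?d E = e"
    using chart_surj[OF bound] by blast
  have "v = E * f" if "bihomogeneous i j v" "bihomogeneous m n f" "?d v = e * ?d f" for v f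
    by (rule chart_eqD[where p = "(1, 0)" and q = "(1, 0)", OF that(1) bihomogeneous_mult[OF E(1) that(2)]])
       (use that E in \<open>auto simp: ring_map_mult[OF ring_map_chart]\<close>)
  then show ?thesis using E(1) e a b c v1 v2 v3 by blast
qed

lemma bihomogeneous_mult_eq_0:
  fixes f g :: "'k::alg_closed_field bipoly"
  assumes "bihomogeneous i j f" "bihomogeneous i' j' g" "f * g = 0" "g \<noteq> 0"
  shows "f = 0"
proof -
  have "std_chart f * std_chart g = 0"
    using assms(3) by (simp flip: ring_map_mult[OF ring_map_chart] add: ring_map_zero[OF ring_map_chart])
  then show ?thesis using chart_eq_0D assms by (metis mult_eq_0_iff)
qed

section \<open>Gluing the charts\<close>

lemma X_of_power: "X_of x ^ N = Poly_Mapping.single (Poly_Mapping.single x N) 1"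
  by (induction N) (simp_all add: X_of_def mult_single flip: single_add)

lemma lookup_X_of_power_mult:
  "Poly_Mapping.lookup (X_of x ^ N * f) (Poly_Mapping.single x N + e) = Poly_Mapping.lookup f e"
proof -
  have "X_of x ^ N * f = (\<Sum>e'\<in>Poly_Mapping.keys f.
      Poly_Mapping.single (Poly_Mapping.single x N + e') (Poly_Mapping.lookup f e'))"
    by (subst (1) poly_mapping_sum_singles[of f]) (simp add: X_of_power sum_distrib_left mult_single)
  then show ?thesis
    by (auto simp: lookup_sum lookup_single when_def in_keys_iff)
qed

lemma keys_X_of_power_mult:
  "Poly_Mapping.keys (X_of x ^ N * f) = (+) (Poly_Mapping.single x N) ` Poly_Mapping.keys f"
proof
  show "(+) (Poly_Mapping.single x N) ` Poly_Mapping.keys f \<subseteq> Poly_Mapping.keys (X_of x ^ N * f)"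
    by (auto simp: in_keys_iff lookup_X_of_power_mult)
  show "Poly_Mapping.keys (X_of x ^ N * f) \<subseteq> (+) (Poly_Mapping.single x N) ` Poly_Mapping.keys f"
    using Poly_Mapping.keys_mult[of "X_of x ^ N" f] by (auto simp: X_of_power)
qed

lemma X_of_power_mult_cancel: "X_of x ^ N * f = X_of x ^ N * g \<longleftrightarrow> f = g"
proof
  assume "X_of x ^ N * f = X_of x ^ N * g"
  then show "f = g" by (metis lookup_X_of_power_mult poly_mapping_eqI)
qed simp

lemma divisible_by_X_of_power:
  assumes "\<And>e. e \<in> Poly_Mapping.keys f \<Longrightarrow> N \<le> Poly_Mapping.lookup e x"
  shows "\<exists>g. f = X_of x ^ N * g"
proof
  have *: "Poly_Mapping.single x N + (e - Poly_Mapping.single x N) = e" if "e \<in> Poly_Mapping.keys f" for e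
    using assms[OF that] by (intro poly_mapping_eqI) (auto simp: lookup_add lookup_minus lookup_single when_def)
  have "f = (\<Sum>e\<in>Poly_Mapping.keys f. Poly_Mapping.single e (Poly_Mapping.lookup f e))"
    by (rule poly_mapping_sum_singles)
  also have "\<dots> = X_of x ^ N * (\<Sum>e\<in>Poly_Mapping.keys f.
      Poly_Mapping.single (e - Poly_Mapping.single x N) (Poly_Mapping.lookup f e))"
    using * by (simp add: X_of_power sum_distrib_left mult_single)
  finally show "f = X_of x ^ N * (\<Sum>e\<in>Poly_Mapping.keys f.
      Poly_Mapping.single (e - Poly_Mapping.single x N) (Poly_Mapping.lookup f e))" .
qed

lemma X_of_power_mult_eqD:
  assumes "X_of y ^ N * f = X_of x ^ N * g" "x \<noteq> y"
  shows "\<exists>f'. f = X_of x ^ N * f' \<and> g = X_of y ^ N * f'"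
proof -
  have "N \<le> Poly_Mapping.lookup e x" if "e \<in> Poly_Mapping.keys f" for e
  proof -
    have "Poly_Mapping.single y N + e \<in> Poly_Mapping.keys (X_of x ^ N * g)"
      using that unfolding assms(1)[symmetric] keys_X_of_power_mult by simp
    then obtain e' where "Poly_Mapping.single y N + e = Poly_Mapping.single x N + e'"
      unfolding keys_X_of_power_mult by blast
    then have "Poly_Mapping.lookup (Poly_Mapping.single y N + e) x = Poly_Mapping.lookup (Poly_Mapping.single x N + e') x"
      by simp
    then show ?thesis using assms(2) by (simp add: lookup_add lookup_single)
  qed
  then obtain f' where f': "f = X_of x ^ N * f'" using divisible_by_X_of_power by blast
  have "X_of x ^ N * (X_of y ^ N * f') = X_of x ^ N * g"
    using assms(1) unfolding f' by (simp add: mult_ac)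
  then show ?thesis using f' by (auto simp: X_of_power_mult_cancel)
qed

definition xdeg :: "var \<Rightarrow> int" where "xdeg x = (if x \<in> {VS, VU} then 1 else 0)"
definition ydeg :: "var \<Rightarrow> int" where "ydeg x = (if x \<in> {VS, VU} then 0 else 1)"

lemma bihomogeneous_X_of_power: "bihomogeneous (int N * xdeg x) (int N * ydeg x) (X_of x ^ N)"
  using bihomogeneous_power[OF bihomogeneous_X_of[of x] refl refl, of N] by (simp add: xdeg_def ydeg_def)

lemma bihomogeneous_X_of_power_mult:
  "bihomogeneous i j f \<Longrightarrow> i' = int N * xdeg x + i \<Longrightarrow> j' = int N * ydeg x + j \<Longrightarrow>
    bihomogeneous i' j' (X_of x ^ N * f)"
  by (rule bihomogeneous_mult[OF bihomogeneous_X_of_power])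

lemma bihomogeneous_X_of_power_multD:
  assumes "bihomogeneous (int N * xdeg x + i) (int N * ydeg x + j) (X_of x ^ N * f)"
  shows "bihomogeneous i j f"
  unfolding bihomogeneous_def
proof
  fix e assume "e \<in> Poly_Mapping.keys f"
  then have "Poly_Mapping.single x N + e \<in> Poly_Mapping.keys (X_of x ^ N * f)"
    by (simp add: keys_X_of_power_mult)
  from assms[unfolded bihomogeneous_def, rule_format, OF this]
  show "int (Poly_Mapping.lookup e VS + Poly_Mapping.lookup e VU) = i \<and>
      int (Poly_Mapping.lookup e VT + Poly_Mapping.lookup e VV) = j"
    by (cases x) (simp_all add: lookup_add lookup_single xdeg_def ydeg_def)
qed

text \<open>
  Membership in the monomial ideal \<open>\<langle>x^N, y^N\<rangle>\<close>, expressed by exponents.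
\<close>

definition in_powers :: "var \<Rightarrow> var \<Rightarrow> nat \<Rightarrow> 'k::comm_ring_1 bipoly \<Rightarrow> bool" where
  "in_powers x y N f \<longleftrightarrow>
     (\<forall>e\<in>Poly_Mapping.keys f. N \<le> Poly_Mapping.lookup e x \<or> N \<le> Poly_Mapping.lookup e y)"

lemma in_powers_split:
  assumes f: "bihomogeneous i j f" "in_powers x y N f"
  shows "\<exists>g h. f = X_of x ^ N * g + X_of y ^ N * h \<and>
    bihomogeneous (i - int N * xdeg y) (j - int N * ydeg y) h"
proof -
  define S where "S = {e \<in> Poly_Mapping.keys f. N \<le> Poly_Mapping.lookup e x}"
  define part where "part S = (\<Sum>e\<in>S. Poly_Mapping.single e (Poly_Mapping.lookup f e))" for S
  have keys_part: "Poly_Mapping.keys (part S) \<subseteq> S" if "finite S" for S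
    using keys_sum[of "\<lambda>e. Poly_Mapping.single e (Poly_Mapping.lookup f e)" S]
    unfolding part_def by (auto split: if_splits)
  have fin: "finite S" "finite (Poly_Mapping.keys f - S)" by (auto simp: S_def)
  obtain g where g: "part S = X_of x ^ N * g"
    using divisible_by_X_of_power[of "part S" N x] keys_part[OF fin(1)] by (auto simp: S_def)
  obtain h where h: "part (Poly_Mapping.keys f - S) = X_of y ^ N * h"
    using divisible_by_X_of_power[of "part (Poly_Mapping.keys f - S)" N y] keys_part[OF fin(2)] f(2)
    by (auto simp: S_def in_powers_def)
  have "f = part (Poly_Mapping.keys f)" unfolding part_def by (rule poly_mapping_sum_singles)
  also have "\<dots> = part (Poly_Mapping.keys f - S) + part S"
    unfolding part_def by (rule sum.subset_diff) (auto simp: S_def)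
  finally have "f = X_of x ^ N * g + X_of y ^ N * h" by (simp add: g h add.commute)
  moreover have "bihomogeneous i j (X_of y ^ N * h)"
    using f(1) keys_part[OF fin(2)] unfolding h[symmetric] bihomogeneous_def by blast
  then have "bihomogeneous (i - int N * xdeg y) (j - int N * ydeg y) h"
    by - (rule bihomogeneous_X_of_power_multD[of N y], simp)
  ultimately show ?thesis by blast
qed

lemma in_powers_pigeonhole:
  assumes "bihomogeneous i j f"
    and "x = VS \<and> y = VU \<and> i \<ge> 2 * int N - 1 \<or> x = VT \<and> y = VV \<and> j \<ge> 2 * int N - 1"
  shows "in_powers x y N f"
  unfolding in_powers_def
proof
  fix e assume e: "e \<in> Poly_Mapping.keys f"
  show "N \<le> Poly_Mapping.lookup e x \<or> N \<le> Poly_Mapping.lookup e y"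
    using assms(1)[unfolded bihomogeneous_def, rule_format, OF e] assms(2) by auto
qed

text \<open>
  The monomials of \<open>y^N f\<close> have exponent less than \<open>N\<close> in \<open>z\<close>, those of \<open>z^N g\<close> at least \<open>N\<close>. So the
  former are not cancelled and occur on the right-hand side.
\<close>

lemma in_powers_cocycle:
  assumes eq: "X_of y ^ N * f - X_of z ^ N * g = X_of x' ^ N * p - X_of x ^ N * q"
    and small: "\<And>e. e \<in> Poly_Mapping.keys f \<Longrightarrow> Poly_Mapping.lookup e z < N"
    and distinct: "y \<noteq> z" "y \<noteq> x" "y \<noteq> x'"
  shows "in_powers x x' N f"
  unfolding in_powers_def
proof
  fix e assume e: "e \<in> Poly_Mapping.keys f"
  define e' where "e' = Poly_Mapping.single y N + e"
  have notin: "e' \<notin> Poly_Mapping.keys (X_of z ^ N * g)"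
  proof
    assume "e' \<in> Poly_Mapping.keys (X_of z ^ N * g)"
    then obtain d where "e' = Poly_Mapping.single z N + d" unfolding keys_X_of_power_mult by blast
    then have "N \<le> Poly_Mapping.lookup e' z" by (simp add: lookup_add)
    then show False using small[OF e] distinct by (simp add: e'_def lookup_add lookup_single)
  qed
  have "Poly_Mapping.lookup (X_of y ^ N * f - X_of z ^ N * g) e' = Poly_Mapping.lookup f e"
    using notin by (simp add: lookup_minus e'_def lookup_X_of_power_mult in_keys_iff)
  then have "Poly_Mapping.lookup (X_of x' ^ N * p - X_of x ^ N * q) e' \<noteq> 0"
    using e by (simp add: eq in_keys_iff)
  then have "e' \<in> Poly_Mapping.keys (X_of x' ^ N * p) \<or> e' \<in> Poly_Mapping.keys (X_of x ^ N * q)"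
    by (auto simp: lookup_minus in_keys_iff)
  then have "N \<le> Poly_Mapping.lookup e' x \<or> N \<le> Poly_Mapping.lookup e' x'"
    unfolding keys_X_of_power_mult by (auto simp: lookup_add)
  then show "N \<le> Poly_Mapping.lookup e x \<or> N \<le> Poly_Mapping.lookup e x'"
    using distinct by (simp add: e'_def lookup_add lookup_single)
qed

text \<open>
  Over \<open>x \<noteq> 0\<close> and over \<open>y \<noteq> 0\<close> the syzygy \<open>(A, B, C)\<close> is the image of \<open>h / x^N\<close> and of \<open>g / y^N\<close>. On the
  overlap these differ by an element of the kernel of the Koszul map, that is, by a multiple of
  \<open>(b, -c, -a)\<close>; the factor \<open>e / (x y)^N\<close> is a Cech cocycle.
\<close>

lemma koszul_via_difference:
  fixes a b c A B C :: "'k::alg_closed_field bipoly"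
  assumes a: "bihomogeneous m n a" and b: "bihomogeneous m n b" and c: "bihomogeneous m n c"
    and fin: "finite (zero_set {a, b, c})"
    and h: "koszul_via i j a b c (X_of x ^ N * A) (X_of x ^ N * B) (X_of x ^ N * C) h1 h2 h3"
    and g: "koszul_via i j a b c (X_of y ^ N * A) (X_of y ^ N * B) (X_of y ^ N * C) g1 g2 g3"
    and deg: "xdeg x = xdeg y" "ydeg x = ydeg y"
    and ij: "i' = int N * xdeg y + i - m" "j' = int N * ydeg y + j - n"
  shows "\<exists>e. bihomogeneous i' j' e \<and>
    X_of y ^ N * h1 - X_of x ^ N * g1 = e * b \<and> X_of y ^ N * h2 - X_of x ^ N * g2 = - e * c \<and>
    X_of y ^ N * h3 - X_of x ^ N * g3 = - e * a"
proof -
  define X where "X = X_of x ^ N * (1 :: 'k bipoly)"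
  define Y where "Y = X_of y ^ N * (1 :: 'k bipoly)"
  have XY: "X_of x ^ N = X" "X_of y ^ N = Y" by (simp_all add: X_def Y_def)
  define d1 where "d1 = Y * h1 - X * g1"
  define d2 where "d2 = Y * h2 - X * g2"
  define d3 where "d3 = Y * h3 - X * g3"
  have bi: "bihomogeneous (int N * xdeg y + i) (int N * ydeg y + j) (Y * h - X * g)"
    if "bihomogeneous i j h" "bihomogeneous i j g" for h g
    unfolding XY[symmetric] using that deg
    by (auto intro!: bihomogeneous_diff bihomogeneous_X_of_power_mult)
  have bi3: "bihomogeneous (int N * xdeg y + i) (int N * ydeg y + j) (- d3)"
    "bihomogeneous (int N * xdeg y + i) (int N * ydeg y + j) d1"
    "bihomogeneous (int N * xdeg y + i) (int N * ydeg y + j) (- d2)"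
    unfolding d1_def d2_def d3_def using h g
    by (auto simp only: koszul_via_def intro!: bi bihomogeneous_uminus)
  have H: "X * A = h1 * c + h2 * b" "X * B = - h2 * a + h3 * c" "X * C = - h1 * a - h3 * b"
    and G: "Y * A = g1 * c + g2 * b" "Y * B = - g2 * a + g3 * c" "Y * C = - g1 * a - g3 * b"
    using h g by (simp_all add: koszul_via_def XY)
  have 1: "(- d3) * b = d1 * a"
  proof -
    have "(- d3) * b - d1 * a = Y * (- h1 * a - h3 * b) - X * (- g1 * a - g3 * b)"
      by (simp add: d1_def d3_def algebra_simps)
    also have "\<dots> = 0" unfolding H[symmetric] G[symmetric] by (simp add: algebra_simps)
    finally show ?thesis by (simp only: right_minus_eq)
  qed
  have 2: "(- d3) * c = (- d2) * a"
  proof (rule sym)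
    have "(- d2) * a - (- d3) * c = Y * (- h2 * a + h3 * c) - X * (- g2 * a + g3 * c)"
      by (simp add: d2_def d3_def algebra_simps)
    also have "\<dots> = 0" unfolding H[symmetric] G[symmetric] by (simp add: algebra_simps)
    finally show "(- d2) * a = (- d3) * c" by (simp only: right_minus_eq)
  qed
  have 3: "d1 * c = (- d2) * b"
  proof -
    have "d1 * c - (- d2) * b = Y * (h1 * c + h2 * b) - X * (g1 * c + g2 * b)"
      by (simp add: d1_def d2_def algebra_simps)
    also have "\<dots> = 0" unfolding H[symmetric] G[symmetric] by (simp add: algebra_simps)
    finally show ?thesis by (simp only: right_minus_eq)
  qed
  obtain e where e: "bihomogeneous i' j' e" "- d3 = e * a" "d1 = e * b" "- d2 = e * c"
    using proportional_bihomogeneous[OF a b c fin bi3 1 2 3] unfolding ij by blast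
  have "d2 = - e * c" "d3 = - e * a" using e(2,4) by (metis minus_minus minus_mult_left)+
  then show ?thesis using e(1,3) unfolding XY d1_def d2_def d3_def by blast
qed

text \<open>
  A cocycle \<open>e / (x y)^N\<close> with \<open>e = x^N e2 + y^N e1\<close> is a coboundary. Subtracting \<open>e1 / x^N\<close> times
  \<open>(b, -c, -a)\<close> from \<open>h / x^N\<close> and adding \<open>e2 / y^N\<close> times it to \<open>g / y^N\<close> makes these agree on the
  overlap, so they glue to a preimage of \<open>(A, B, C)\<close> without denominators.
\<close>

lemma koszul_via_descent:
  fixes a b c A B C :: "'k::alg_closed_field bipoly"
  assumes a: "bihomogeneous m n a" and b: "bihomogeneous m n b" and c: "bihomogeneous m n c"
    and h: "koszul_via (int N * xdeg x + i) (int N * ydeg x + j) a b c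
      (X_of x ^ N * A) (X_of x ^ N * B) (X_of x ^ N * C) h1 h2 h3"
    and e: "bihomogeneous i' j' e" "in_powers x y N e"
    and ij: "i' = int N * xdeg x + int N * xdeg y + i - m" "j' = int N * ydeg x + int N * ydeg y + j - n"
    and diff: "X_of y ^ N * h1 - X_of x ^ N * g1 = e * b" "X_of y ^ N * h2 - X_of x ^ N * g2 = - e * c"
      "X_of y ^ N * h3 - X_of x ^ N * g3 = - e * a"
    and xy: "x \<noteq> y"
  shows "\<exists>f1 f2 f3. koszul_via i j a b c A B C f1 f2 f3"
proof -
  obtain e2 e1 where e12: "e = X_of x ^ N * e2 + X_of y ^ N * e1"
    "bihomogeneous (i' - int N * xdeg y) (j' - int N * ydeg y) e1"
    using in_powers_split[OF e] by blast
  have e1: "bihomogeneous (int N * xdeg x + i - m) (int N * ydeg x + j - n) e1"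
    using e12(2) unfolding ij by (simp add: algebra_simps)
  have "X_of y ^ N * (h1 - e1 * b) = X_of x ^ N * (g1 + e2 * b)"
       "X_of y ^ N * (h2 + e1 * c) = X_of x ^ N * (g2 - e2 * c)"
       "X_of y ^ N * (h3 + e1 * a) = X_of x ^ N * (g3 - e2 * a)"
    using diff unfolding e12(1) by (simp_all add: algebra_simps)
  then obtain f1 f2 f3 where f: "h1 - e1 * b = X_of x ^ N * f1" "h2 + e1 * c = X_of x ^ N * f2"
      "h3 + e1 * a = X_of x ^ N * f3"
    using X_of_power_mult_eqD[OF _ xy] by metis
  have be: "bihomogeneous (int N * xdeg x + i) (int N * ydeg x + j) (e1 * g)" if "bihomogeneous m n g" for g
    by (rule bihomogeneous_mult[OF e1 that]) auto
  have "bihomogeneous i j f1" "bihomogeneous i j f2" "bihomogeneous i j f3"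
    by (rule bihomogeneous_X_of_power_multD[of N x], unfold f[symmetric],
        use h a b c in \<open>auto simp: koszul_via_def intro!: be bihomogeneous_add bihomogeneous_diff\<close>)+
  moreover have h': "h1 = X_of x ^ N * f1 + e1 * b" "h2 = X_of x ^ N * f2 - e1 * c"
      "h3 = X_of x ^ N * f3 - e1 * a"
    using f by (simp_all add: algebra_simps)
  have "X_of x ^ N * A = X_of x ^ N * (f1 * c + f2 * b)"
       "X_of x ^ N * B = X_of x ^ N * (- f2 * a + f3 * c)"
       "X_of x ^ N * C = X_of x ^ N * (- f1 * a - f3 * b)"
    using h unfolding koszul_via_def h' by (auto simp: algebra_simps)
  then have "A = f1 * c + f2 * b" "B = - f2 * a + f3 * c" "C = - f1 * a - f3 * b"
    unfolding X_of_power_mult_cancel by blast+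
  ultimately show ?thesis unfolding koszul_via_def by blast
qed

theorem proposition2p3:
  fixes a b c :: "'k::alg_closed_field bipoly" and m n k l :: int
  assumes "bihomogeneous m n a" and "bihomogeneous m n b" and "bihomogeneous m n c"
    and "finite (zero_set {a, b, c})"
    and "\<And>z. z \<in> zero_set {a, b, c} \<Longrightarrow> curvilinear_at (ideal_gen {a, b, c}) z"
    and "(k - 2 * m + 1) * (l - 2 * n + 1) \<ge> 0"
  shows "\<forall>A B C :: 'k bipoly.
    bihomogeneous k l A \<longrightarrow> bihomogeneous k l B \<longrightarrow> bihomogeneous k l C \<longrightarrow>
    A * a + B * b + C * c = 0 \<longrightarrow>
    {A, B, C} \<subseteq> saturation (ideal_gen {a, b, c}) \<longrightarrow>
    (\<exists>h1 h2 h3 :: 'k bipoly.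
       bihomogeneous (k - m) (l - n) h1 \<and> bihomogeneous (k - m) (l - n) h2 \<and>
       bihomogeneous (k - m) (l - n) h3 \<and>
       A = h1 * c + h2 * b \<and> B = - h2 * a + h3 * c \<and> C = - h1 * a - h3 * b)"
proof (intro allI impI)
  fix A B C :: "'k bipoly"
  assume A: "bihomogeneous k l A" and B: "bihomogeneous k l B" and C: "bihomogeneous k l C"
    and syz: "A * a + B * b + C * c = 0"
    and sat: "{A, B, C} \<subseteq> saturation (ideal_gen {a, b, c})"
  note abc = assms(1-3) and fin = assms(4)
  have "\<exists>N0. \<forall>N\<ge>N0. \<exists>h1 h2 h3. koszul_via (int N + k - m) (int N + l - n) a b c
      (chart_unit VS VU p ^ N * chart_unit VT VV q ^ N * A)
      (chart_unit VS VU p ^ N * chart_unit VT VV q ^ N * B)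
      (chart_unit VS VU p ^ N * chart_unit VT VV q ^ N * C) h1 h2 h3" for p q
    using koszul_up_to_power[OF abc A B C koszul_on_chart[OF abc fin assms(5) A B C syz sat]] .
  then obtain N0 where N0: "\<And>p q N. N \<ge> N0 p q \<Longrightarrow> \<exists>h1 h2 h3. koszul_via (int N + k - m) (int N + l - n) a b c
      (chart_unit VS VU p ^ N * chart_unit VT VV q ^ N * A)
      (chart_unit VS VU p ^ N * chart_unit VT VV q ^ N * B)
      (chart_unit VS VU p ^ N * chart_unit VT VV q ^ N * C) h1 h2 h3"
    by metis
  define N where "N = N0 (1, 0) (1, 0) + N0 (1, 0) (0, 1) + N0 (0, 1) (1, 0) + N0 (0, 1) (0, 1)"
  have corner: "\<exists>h1 h2 h3. koszul_via (int N + k - m) (int N + l - n) a b c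
      (X_of x ^ N * (X_of y ^ N * A)) (X_of x ^ N * (X_of y ^ N * B)) (X_of x ^ N * (X_of y ^ N * C)) h1 h2 h3"
    if x: "x \<in> {VS, VU}" and y: "y \<in> {VT, VV}" for x y
  proof -
    define p where "p = (if x = VS then (1, 0) else (0, 1) :: 'k \<times> 'k)"
    define q where "q = (if y = VT then (1, 0) else (0, 1) :: 'k \<times> 'k)"
    have "chart_unit VS VU p = X_of x" "chart_unit VT VV q = X_of y"
      using x y by (auto simp: chart_unit_def p_def q_def)
    moreover have "N \<ge> N0 p q" unfolding p_def q_def N_def by auto
    ultimately show ?thesis using N0[of p q N] by (simp add: mult.assoc)
  qed
  \<comment> \<open>The four standard charts have denominators \<open>st\<close>, \<open>sv\<close>, \<open>ut\<close>, \<open>uv\<close>.\<close>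
  obtain st1 st2 st3 where st: "koszul_via (int N + k - m) (int N + l - n) a b c
      (X_of VS ^ N * (X_of VT ^ N * A)) (X_of VS ^ N * (X_of VT ^ N * B)) (X_of VS ^ N * (X_of VT ^ N * C)) st1 st2 st3"
    using corner[of VS VT] by auto
  obtain sv1 sv2 sv3 where sv: "koszul_via (int N + k - m) (int N + l - n) a b c
      (X_of VS ^ N * (X_of VV ^ N * A)) (X_of VS ^ N * (X_of VV ^ N * B)) (X_of VS ^ N * (X_of VV ^ N * C)) sv1 sv2 sv3"
    using corner[of VS VV] by auto
  obtain ut1 ut2 ut3 where ut: "koszul_via (int N + k - m) (int N + l - n) a b c
      (X_of VU ^ N * (X_of VT ^ N * A)) (X_of VU ^ N * (X_of VT ^ N * B)) (X_of VU ^ N * (X_of VT ^ N * C)) ut1 ut2 ut3"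
    using corner[of VU VT] by auto
  obtain uv1 uv2 uv3 where uv: "koszul_via (int N + k - m) (int N + l - n) a b c
      (X_of VU ^ N * (X_of VV ^ N * A)) (X_of VU ^ N * (X_of VV ^ N * B)) (X_of VU ^ N * (X_of VV ^ N * C)) uv1 uv2 uv3"
    using corner[of VU VV] by auto
  define M where "M = int N"
  note degs = xdeg_def ydeg_def M_def
  \<comment> \<open>Cocycles of the gluing along \<open>s, u\<close>, over \<open>t \<noteq> 0\<close> and over \<open>v \<noteq> 0\<close>.\<close>
  obtain et where et: "bihomogeneous (2 * M + k - 2 * m) (M + l - 2 * n) et"
    "X_of VU ^ N * st1 - X_of VS ^ N * ut1 = et * b" "X_of VU ^ N * st2 - X_of VS ^ N * ut2 = - et * c"
    "X_of VU ^ N * st3 - X_of VS ^ N * ut3 = - et * a"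
    using koszul_via_difference[OF abc fin st ut, of "2 * M + k - 2 * m" "M + l - 2 * n"]
    by (auto simp: degs)
  obtain ev where ev: "bihomogeneous (2 * M + k - 2 * m) (M + l - 2 * n) ev"
    "X_of VU ^ N * sv1 - X_of VS ^ N * uv1 = ev * b" "X_of VU ^ N * sv2 - X_of VS ^ N * uv2 = - ev * c"
    "X_of VU ^ N * sv3 - X_of VS ^ N * uv3 = - ev * a"
    using koszul_via_difference[OF abc fin sv uv, of "2 * M + k - 2 * m" "M + l - 2 * n"]
    by (auto simp: degs)
  have powers: "in_powers VS VU N et \<and> in_powers VS VU N ev"
  proof (cases "k - 2 * m \<ge> -1")
    case True
    then show ?thesis
      by (intro conjI in_powers_pigeonhole[OF et(1)] in_powers_pigeonhole[OF ev(1)]) (simp_all add: M_def)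
  next
    case False
    then have neg: "l - 2 * n \<le> -1"
      using assms(6) by (smt (verit) mult_neg_pos)
    \<comment> \<open>Here the degree in \<open>s, u\<close> is too small for the pigeonhole. Going around the four charts
      relates \<open>et\<close> and \<open>ev\<close> to the cocycles \<open>es\<close>, \<open>eu\<close> of the gluing along \<open>t, v\<close>.\<close>
    have comm: "X_of x ^ N * (X_of y ^ N * F) = X_of y ^ N * (X_of x ^ N * F)" for x y and F :: "'k bipoly"
      by (simp add: mult_ac)
    obtain es where es: "bihomogeneous (M + k - 2 * m) (2 * M + l - 2 * n) es"
      "X_of VV ^ N * st1 - X_of VT ^ N * sv1 = es * b" "X_of VV ^ N * st2 - X_of VT ^ N * sv2 = - es * c"
      "X_of VV ^ N * st3 - X_of VT ^ N * sv3 = - es * a"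
      using koszul_via_difference[OF abc fin st[unfolded comm[of VS]] sv[unfolded comm[of VS]],
          of "M + k - 2 * m" "2 * M + l - 2 * n"]
      by (auto simp: degs)
    obtain eu where eu: "bihomogeneous (M + k - 2 * m) (2 * M + l - 2 * n) eu"
      "X_of VV ^ N * ut1 - X_of VT ^ N * uv1 = eu * b" "X_of VV ^ N * ut2 - X_of VT ^ N * uv2 = - eu * c"
      "X_of VV ^ N * ut3 - X_of VT ^ N * uv3 = - eu * a"
      using koszul_via_difference[OF abc fin ut[unfolded comm[of VU]] uv[unfolded comm[of VU]],
          of "M + k - 2 * m" "2 * M + l - 2 * n"]
      by (auto simp: degs)
    define D where "D = (X_of VV ^ N * et - X_of VT ^ N * ev) - (X_of VU ^ N * es - X_of VS ^ N * eu)"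
    have D: "bihomogeneous (2 * M + k - 2 * m) (2 * M + l - 2 * n) D"
      unfolding D_def
      by (intro bihomogeneous_diff bihomogeneous_X_of_power_mult[OF et(1)]
          bihomogeneous_X_of_power_mult[OF ev(1)] bihomogeneous_X_of_power_mult[OF es(1)]
          bihomogeneous_X_of_power_mult[OF eu(1)]) (simp_all add: degs)
    have "D * b = X_of VV ^ N * (et * b) - X_of VT ^ N * (ev * b) - (X_of VU ^ N * (es * b) - X_of VS ^ N * (eu * b))"
      by (simp add: D_def algebra_simps)
    also have "\<dots> = 0" unfolding et(2)[symmetric] ev(2)[symmetric] es(2)[symmetric] eu(2)[symmetric]
      by (simp add: algebra_simps)
    finally have Db: "D * b = 0" .
    have "D * c = - (X_of VV ^ N * (- et * c) - X_of VT ^ N * (- ev * c) - (X_of VU ^ N * (- es * c) - X_of VS ^ N * (- eu * c)))"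
      by (simp add: D_def algebra_simps)
    also have "\<dots> = 0" unfolding et(3)[symmetric] ev(3)[symmetric] es(3)[symmetric] eu(3)[symmetric]
      by (simp add: algebra_simps)
    finally have Dc: "D * c = 0" .
    have "D * a = - (X_of VV ^ N * (- et * a) - X_of VT ^ N * (- ev * a) - (X_of VU ^ N * (- es * a) - X_of VS ^ N * (- eu * a)))"
      by (simp add: D_def algebra_simps)
    also have "\<dots> = 0" unfolding et(4)[symmetric] ev(4)[symmetric] es(4)[symmetric] eu(4)[symmetric]
      by (simp add: algebra_simps)
    finally have Da: "D * a = 0" .
    obtain f where "f \<in> {a, b, c}" "f \<noteq> 0"
      using not_all_vanish_on_line(1)[OF abc fin] std_chart_full_degree(1) abc by blast
    then have "D = 0" using bihomogeneous_mult_eq_0[OF D] abc Da Db Dc by blast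
    then have cocycle: "X_of VV ^ N * et - X_of VT ^ N * ev = X_of VU ^ N * es - X_of VS ^ N * eu"
      by (simp add: D_def)
    then have cocycle': "X_of VT ^ N * ev - X_of VV ^ N * et = X_of VU ^ N * (- es) - X_of VS ^ N * (- eu)"
      by (simp add: algebra_simps)
    show ?thesis
    proof
      show "in_powers VS VU N et"
        by (rule in_powers_cocycle[OF cocycle]) (use et(1) neg in \<open>force simp: bihomogeneous_def M_def\<close>)+
      show "in_powers VS VU N ev"
        by (rule in_powers_cocycle[OF cocycle']) (use ev(1) neg in \<open>force simp: bihomogeneous_def M_def\<close>)+
    qed
  qed
  \<comment> \<open>Glue along \<open>s, u\<close>, and then along \<open>t, v\<close>.\<close>
  have t: "\<exists>t1 t2 t3. koszul_via (k - m) (M + l - n) a b c (X_of VT ^ N * A) (X_of VT ^ N * B) (X_of VT ^ N * C) t1 t2 t3"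
    by (rule koszul_via_descent[OF abc _ et(1) conjunct1[OF powers] _ _ et(2-4)])
       (use st in \<open>simp_all add: degs algebra_simps\<close>)
  have v: "\<exists>v1 v2 v3. koszul_via (k - m) (M + l - n) a b c (X_of VV ^ N * A) (X_of VV ^ N * B) (X_of VV ^ N * C) v1 v2 v3"
    by (rule koszul_via_descent[OF abc _ ev(1) conjunct2[OF powers] _ _ ev(2-4)])
       (use sv in \<open>simp_all add: degs algebra_simps\<close>)
  obtain t1 t2 t3 where t: "koszul_via (k - m) (M + l - n) a b c (X_of VT ^ N * A) (X_of VT ^ N * B) (X_of VT ^ N * C) t1 t2 t3"
    using t by blast
  obtain v1 v2 v3 where v: "koszul_via (k - m) (M + l - n) a b c (X_of VV ^ N * A) (X_of VV ^ N * B) (X_of VV ^ N * C) v1 v2 v3"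
    using v by blast
  obtain e where e: "bihomogeneous (k - 2 * m) (2 * M + l - 2 * n) e"
    "X_of VV ^ N * t1 - X_of VT ^ N * v1 = e * b" "X_of VV ^ N * t2 - X_of VT ^ N * v2 = - e * c"
    "X_of VV ^ N * t3 - X_of VT ^ N * v3 = - e * a"
    using koszul_via_difference[OF abc fin t v, of "k - 2 * m" "2 * M + l - 2 * n"]
    by (auto simp: degs)
  have powers': "in_powers VT VV N e"
  proof (cases "l - 2 * n \<ge> -1")
    case True
    then show ?thesis by (intro in_powers_pigeonhole[OF e(1)]) (simp add: M_def)
  next
    case False
    \<comment> \<open>There are no nonzero forms of negative degree.\<close>
    then have "k - 2 * m \<le> -1"
      using assms(6) by (smt (verit) mult_pos_neg)
    then have "Poly_Mapping.keys e = {}" using e(1) by (force simp: bihomogeneous_def)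
    then show ?thesis by (simp add: in_powers_def)
  qed
  have "\<exists>h1 h2 h3. koszul_via (k - m) (l - n) a b c A B C h1 h2 h3"
    by (rule koszul_via_descent[OF abc _ e(1) powers' _ _ e(2-4)])
       (use t in \<open>simp_all add: degs algebra_simps\<close>)
  then show "\<exists>h1 h2 h3.
       bihomogeneous (k - m) (l - n) h1 \<and> bihomogeneous (k - m) (l - n) h2 \<and>
       bihomogeneous (k - m) (l - n) h3 \<and>
       A = h1 * c + h2 * b \<and> B = - h2 * a + h3 * c \<and> C = - h1 * a - h3 * b"
    unfolding koszul_via_def .
qed

end
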